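(* Let $\mathcal Q=\mathcal Q(\mathbf X)$ be a quantum CSS code of non-zero dimension given by a $2$-dimensional chain complex $\mathbf X=(X_0,X_1,X_2)$ over $\mathbb F_2$, with low-density matrices $H_X,H_Z$, and let $C$ be a classical binary LDPC code of non-zero dimension with low-density parity-check matrix $H$ with columns indexed by $A$ and rows indexed by $B$, such that $\operatorname{rank}(H)=|B|$. Then the quantum CSS code $\mathcal Q(\mathcal X)$ of the product complex $\mathcal X$ built from $\mathbf X$ and $H$ is LDPC, and its length $N$, dimension $K$, $X$-distance $D_X$ and $Z$-distance $D_Z$ are $$N=|X_1||A|+|X_2||B|,\qquad K=\dim\mathcal Q\cdot\dim C,\qquad D_X=d_X(\mathcal Q)\,d(C),\qquad D_Z=d_Z(\mathcal Q),$$ where $d_X(\mathcal Q),d_Z(\mathcal Q)$ are the $X$- and $Z$-distances of $\mathcal Q$ and $d(C)$ is the minimum distance of $C$.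
   Context: A $2$-dimensional chain complex $\mathbf X=(X_0,X_1,X_2)$ consists of finite sets $X_i$ and linear maps $\partial_2:\mathbb F_2^{X_2}\to\mathbb F_2^{X_1}$, $\partial_1:\mathbb F_2^{X_1}\to\mathbb F_2^{X_0}$ with $\partial_1\partial_2=0$. Its CSS code $\mathcal Q(\mathbf X)$ has $H_X$ = matrix of $\partial_1$ (rows $X_0$, columns $X_1$) and $H_Z$ = transpose of the matrix of $\partial_2$ (rows $X_2$, columns $X_1$). With row spaces $W_X,W_Z$ and $C_X=W_X^\perp=\ker\partial_1$, $C_Z=W_Z^\perp$, the length is $|X_1|$, the dimension is $\dim C_X/W_Z=\dim C_Z/W_X$, and $d_X$ (resp. $d_Z$) is the smallest Hamming weight of a vector of $C_X\setminus W_Z$ (resp. $C_Z\setminus W_X$). "LDPC/low-density" means row and column weights of the matrices are bounded by a constant. $C=\{x\in\mathbb F_2^A: Hx^T=0\}$. Write $x_0\sim x_1$ (resp. $x_1\sim x_2$, $a\sim b$) when the corresponding entry of $H_X$ (resp. $H_Z$, $H$) is $1$. The product complex $\mathcal X=(\mathcal X_0,\mathcal X_1,\mathcal X_2)$ is $$\mathcal X_0=(X_0\times A)\cup(X_1\times B),\quad \mathcal X_1=(X_1\times A)\cup(X_2\times B),\quad \mathcal X_2=X_2\times A,$$ with boundary maps given on basis elements by $\partial_1^{\mathcal X}(x_1,a)=\sum_{x_0\sim x_1}(x_0,a)+\sum_{b\sim a}(x_1,b)$, $\ \partial_1^{\mathcal X}(x_2,b)=\sum_{x_1\sim x_2}(x_1,b)$,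 $\ \partial_2^{\mathcal X}(x_2,a)=\sum_{x_1\sim x_2}(x_1,a)+\sum_{b\sim a}(x_2,b)$ (sums over $\mathbb F_2$). *)

theory Defs
  imports Complex_Main "HOL-Library.Z2" "HOL-Library.Function_Algebras"
begin

text \<open>
  The field with two elements is the type \<^typ>\<open>bit\<close>. For a finite set \<open>S\<close>, the space of
  vectors indexed by \<open>S\<close> consists of the functions into \<^typ>\<open>bit\<close> that vanish outside \<open>S\<close>.
  A matrix with rows indexed by \<open>R\<close> and columns indexed by \<open>S\<close> is a function \<open>M\<close> of a row
  index and a column index, of which only the values on \<open>R \<times> S\<close> are ever used.
\<close>

definition vscale :: "bit \<Rightarrow> ('a \<Rightarrow> bit) \<Rightarrow> ('a \<Rightarrow> bit)" where
  "vscale c v = (\<lambda>x. c * v x)"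

interpretation f2: vector_space vscale
  by unfold_locales (auto simp: vscale_def fun_eq_iff algebra_simps)

definition vspace :: "'a set \<Rightarrow> ('a \<Rightarrow> bit) set" where
  "vspace S = {v. \<forall>x. x \<notin> S \<longrightarrow> v x = 0}"

definition unit_vec :: "'a \<Rightarrow> 'a \<Rightarrow> bit" where
  "unit_vec x = (\<lambda>y. if y = x then 1 else 0)"

definition linear_extension :: "'a set \<Rightarrow> ('a \<Rightarrow> 'b \<Rightarrow> bit) \<Rightarrow> ('a \<Rightarrow> bit) \<Rightarrow> ('b \<Rightarrow> bit)" where
  "linear_extension S f v = (\<Sum>x\<in>S. vscale (v x) (f x))"

definition linear_map :: "'a set \<Rightarrow> 'b set \<Rightarrow> (('a \<Rightarrow> bit) \<Rightarrow> ('b \<Rightarrow> bit)) \<Rightarrow> bool" where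
  "linear_map S T f \<longleftrightarrow>
     (\<forall>v\<in>vspace S. f v \<in> vspace T) \<and>
     (\<forall>u\<in>vspace S. \<forall>v\<in>vspace S. f (u + v) = f u + f v) \<and>
     (\<forall>c. \<forall>v\<in>vspace S. f (vscale c v) = vscale c (f v))"

definition matrix_row :: "'s set \<Rightarrow> ('r \<Rightarrow> 's \<Rightarrow> bit) \<Rightarrow> 'r \<Rightarrow> ('s \<Rightarrow> bit)" where
  "matrix_row S M r = (\<lambda>s. if s \<in> S then M r s else 0)"

definition row_space :: "'r set \<Rightarrow> 's set \<Rightarrow> ('r \<Rightarrow> 's \<Rightarrow> bit) \<Rightarrow> ('s \<Rightarrow> bit) set" where
  "row_space R S M = f2.span (matrix_row S M ` R)"

definition matrix_rank :: "'r set \<Rightarrow> 's set \<Rightarrow> ('r \<Rightarrow> 's \<Rightarrow> bit) \<Rightarrow> nat" where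
  "matrix_rank R S M = f2.dim (row_space R S M)"

definition orth_compl :: "'s set \<Rightarrow> ('s \<Rightarrow> bit) set \<Rightarrow> ('s \<Rightarrow> bit) set" where
  "orth_compl S W = {v \<in> vspace S. \<forall>w\<in>W. (\<Sum>s\<in>S. v s * w s) = 0}"

text \<open>
  The classes modulo \<open>W\<close> of the elements of \<open>E\<close> are pairwise distinct and form a basis of the
  quotient \<open>V / W\<close>; the coefficients of a linear combination are a vector indexed by \<open>E\<close>.
\<close>

definition quotient_basis ::
  "('a \<Rightarrow> bit) set \<Rightarrow> ('a \<Rightarrow> bit) set \<Rightarrow> ('a \<Rightarrow> bit) set \<Rightarrow> bool" where
  "quotient_basis V W E \<longleftrightarrow>
     E \<subseteq> V \<and> finite E \<and> (\<forall>v\<in>V. \<exists>!c. c \<in> vspace E \<and> v - (\<Sum>e\<in>E. vscale (c e) e) \<in> W)"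

definition quotient_dim :: "('a \<Rightarrow> bit) set \<Rightarrow> ('a \<Rightarrow> bit) set \<Rightarrow> nat" where
  "quotient_dim V W = (THE k. \<exists>E. quotient_basis V W E \<and> card E = k)"

definition hamming_dist :: "('a \<Rightarrow> bit) \<Rightarrow> ('a \<Rightarrow> bit) \<Rightarrow> nat" where
  "hamming_dist u v = card {x. u x \<noteq> v x}"

definition hamming_weight :: "('a \<Rightarrow> bit) \<Rightarrow> nat" where
  "hamming_weight v = card {x. v x \<noteq> 0}"

definition classical_code :: "'b set \<Rightarrow> 'a set \<Rightarrow> ('b \<Rightarrow> 'a \<Rightarrow> bit) \<Rightarrow> ('a \<Rightarrow> bit) set" where
  "classical_code B A H = {v \<in> vspace A. \<forall>b\<in>B. (\<Sum>a\<in>A. H b a * v a) = 0}"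

definition min_distance :: "('a \<Rightarrow> bit) set \<Rightarrow> nat" where
  "min_distance C = Min {hamming_dist u v | u v. u \<in> C \<and> v \<in> C \<and> u \<noteq> v}"

record ('p, 'q, 'r) cell_complex =
  cells0 :: "'p set"
  cells1 :: "'q set"
  cells2 :: "'r set"
  bd1 :: "('q \<Rightarrow> bit) \<Rightarrow> ('p \<Rightarrow> bit)"
  bd2 :: "('r \<Rightarrow> bit) \<Rightarrow> ('q \<Rightarrow> bit)"

definition chain_complex2 :: "('p, 'q, 'r) cell_complex \<Rightarrow> bool" where
  "chain_complex2 X \<longleftrightarrow>
     finite (cells0 X) \<and> finite (cells1 X) \<and> finite (cells2 X) \<and>
     linear_map (cells1 X) (cells0 X) (bd1 X) \<and>
     linear_map (cells2 X) (cells1 X) (bd2 X) \<and>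
     (\<forall>v\<in>vspace (cells2 X). bd1 X (bd2 X v) = 0)"

definition HX :: "('p, 'q, 'r) cell_complex \<Rightarrow> 'p \<Rightarrow> 'q \<Rightarrow> bit" where
  "HX X x0 x1 = bd1 X (unit_vec x1) x0"

definition HZ :: "('p, 'q, 'r) cell_complex \<Rightarrow> 'r \<Rightarrow> 'q \<Rightarrow> bit" where
  "HZ X x2 x1 = bd2 X (unit_vec x2) x1"

definition WX :: "('p, 'q, 'r) cell_complex \<Rightarrow> ('q \<Rightarrow> bit) set" where
  "WX X = row_space (cells0 X) (cells1 X) (HX X)"

definition WZ :: "('p, 'q, 'r) cell_complex \<Rightarrow> ('q \<Rightarrow> bit) set" where
  "WZ X = row_space (cells2 X) (cells1 X) (HZ X)"

definition CX :: "('p, 'q, 'r) cell_complex \<Rightarrow> ('q \<Rightarrow> bit) set" where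
  "CX X = orth_compl (cells1 X) (WX X)"

definition CZ :: "('p, 'q, 'r) cell_complex \<Rightarrow> ('q \<Rightarrow> bit) set" where
  "CZ X = orth_compl (cells1 X) (WZ X)"

definition css_length :: "('p, 'q, 'r) cell_complex \<Rightarrow> nat" where
  "css_length X = card (cells1 X)"

text \<open>
  The dimension of a CSS code is that of \<open>CX / WZ\<close>, which equals that of \<open>CZ / WX\<close>.
\<close>

definition css_dim :: "('p, 'q, 'r) cell_complex \<Rightarrow> nat" where
  "css_dim X = quotient_dim (CX X) (WZ X)"

definition dX :: "('p, 'q, 'r) cell_complex \<Rightarrow> nat" where
  "dX X = Min (hamming_weight ` (CX X - WZ X))"

definition dZ :: "('p, 'q, 'r) cell_complex \<Rightarrow> nat" where
  "dZ X = Min (hamming_weight ` (CZ X - WX X))"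

text \<open>
  Being low-density is a property of a family of matrices: row and column weights are bounded
  by one constant for the whole family.
\<close>

definition low_density ::
  "('i \<Rightarrow> 'r set) \<Rightarrow> ('i \<Rightarrow> 's set) \<Rightarrow> ('i \<Rightarrow> 'r \<Rightarrow> 's \<Rightarrow> bit) \<Rightarrow> bool" where
  "low_density R S M \<longleftrightarrow>
     (\<exists>w. \<forall>i. (\<forall>r\<in>R i. card {s \<in> S i. M i r s = 1} \<le> w) \<and>
               (\<forall>s\<in>S i. card {r \<in> R i. M i r s = 1} \<le> w))"

definition ldpc_css_family :: "('i \<Rightarrow> ('p, 'q, 'r) cell_complex) \<Rightarrow> bool" where
  "ldpc_css_family X \<longleftrightarrow>
     (\<forall>i. chain_complex2 (X i)) \<and>
     low_density (\<lambda>i. cells0 (X i)) (\<lambda>i. cells1 (X i)) (\<lambda>i. HX (X i)) \<and>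
     low_density (\<lambda>i. cells2 (X i)) (\<lambda>i. cells1 (X i)) (\<lambda>i. HZ (X i))"

text \<open>
  The disjoint unions of cells of the product complex are formed with \<^const>\<open>Inl\<close> and
  \<^const>\<open>Inr\<close>, and the boundary maps are the linear extensions of their values on cells.
\<close>

fun product_bd1_cell ::
  "('p, 'q, 'r) cell_complex \<Rightarrow> 'b set \<Rightarrow> ('b \<Rightarrow> 'a \<Rightarrow> bit) \<Rightarrow>
   ('q \<times> 'a) + ('r \<times> 'b) \<Rightarrow> ('p \<times> 'a) + ('q \<times> 'b) \<Rightarrow> bit" where
  "product_bd1_cell X B H (Inl (x1, a)) =
     (\<Sum>x0\<in>{x0 \<in> cells0 X. HX X x0 x1 = 1}. unit_vec (Inl (x0, a))) +
     (\<Sum>b\<in>{b \<in> B. H b a = 1}. unit_vec (Inr (x1, b)))"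
| "product_bd1_cell X B H (Inr (x2, b)) =
     (\<Sum>x1\<in>{x1 \<in> cells1 X. HZ X x2 x1 = 1}. unit_vec (Inr (x1, b)))"

fun product_bd2_cell ::
  "('p, 'q, 'r) cell_complex \<Rightarrow> 'b set \<Rightarrow> ('b \<Rightarrow> 'a \<Rightarrow> bit) \<Rightarrow>
   'r \<times> 'a \<Rightarrow> ('q \<times> 'a) + ('r \<times> 'b) \<Rightarrow> bit" where
  "product_bd2_cell X B H (x2, a) =
     (\<Sum>x1\<in>{x1 \<in> cells1 X. HZ X x2 x1 = 1}. unit_vec (Inl (x1, a))) +
     (\<Sum>b\<in>{b \<in> B. H b a = 1}. unit_vec (Inr (x2, b)))"

definition product_complex ::
  "('p, 'q, 'r) cell_complex \<Rightarrow> 'b set \<Rightarrow> 'a set \<Rightarrow> ('b \<Rightarrow> 'a \<Rightarrow> bit) \<Rightarrow>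
   (('p \<times> 'a) + ('q \<times> 'b), ('q \<times> 'a) + ('r \<times> 'b), 'r \<times> 'a) cell_complex" where
  "product_complex X B A H =
     \<lparr> cells0 = (cells0 X \<times> A) <+> (cells1 X \<times> B),
       cells1 = (cells1 X \<times> A) <+> (cells2 X \<times> B),
       cells2 = cells2 X \<times> A,
       bd1 = linear_extension ((cells1 X \<times> A) <+> (cells2 X \<times> B)) (product_bd1_cell X B H),
       bd2 = linear_extension (cells2 X \<times> A) (product_bd2_cell X B H) \<rparr>"

end

theory Submission
  imports Defs "HOL-Library.FuncSet"
begin

text \<open>
  The product complex is the tensor product of \<open>X\<close> with the map \<open>H\<close>, and since \<open>H\<close> is onto, its
  first homology is \<open>H\<^sub>1(X) \<otimes> C\<close>: the class of a cycle is determined by the family of classes of its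
  rows \<open>v(-, a)\<close>, \<open>a \<in> A\<close>, and the families that occur are those with all coordinates in \<open>C\<close>. Counting
  them gives the dimension. For a cycle that is not a boundary some coordinate is a nonzero codeword,
  so at least \<open>d(C)\<close> rows are homologically nontrivial, each of weight at least \<open>d\<^sub>X\<close>; tensor products
  attain the bound. Dually, a cocycle is a coboundary if and only if all combinations of its rows
  with coefficients in \<open>C\<close> are, and taking such a combination does not increase the weight.
\<close>

text \<open>
  These rewrite ring operations on bits to bit operations, out of reach of ring normalization.
\<close>
declare add_bit_eq_xor [simp del] mult_bit_eq_and [simp del]

subsection \<open>Linear algebra over the two-element field\<close>

text \<open>Surjectivity of \<open>H\<close> enters only through a matrix \<open>S\<close> with
  \<open>H S = 1\<close>: it lifts data indexed by \<open>B\<close> to \<open>A\<close>, and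
  \<open>1 - S H\<close> is a projection onto \<open>C\<close>. It is replaced by a coordinate map
  on \<open>V\<close> with kernel \<open>W\<close> and an explicit section. All spaces being finite,
  a dimension is the exponent of 2 in a quotient of cardinalities. The tensor product of the
  homology of \<open>X\<close> with \<open>C\<close> thus occurs only as the set of functions from a
  quotient basis to \<open>C\<close>, and no basis of the homology of the product is ever written
  down. The two distances differ because the \<open>A\<close> direction contributes the subspace
  \<open>C\<close> to homology, where nonzero elements have weight at least the minimum distance,
  but the quotient of all vectors on \<open>A\<close> by the row space of \<open>H\<close> to
  cohomology, where some unit vector already represents a nonzero class.\<close>

lemma bit_add_self [simp]: "(x::bit) + x = 0"
  by (cases x) auto

lemma bit_add_eq_0_iff [simp]: "(x::bit) + y = 0 \<longleftrightarrow> x = y"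
  by (cases x; cases y) auto

lemma bit_add_eq_iff: "(x::bit) + y = z \<longleftrightarrow> x = z + y"
  by (cases x; cases y; cases z) auto

lemma fun_diff_eq_add: "(u - v :: 'a \<Rightarrow> bit) = u + v"
  by (auto simp: fun_eq_iff)

lemma fun_add_eq_0_iff: "(u :: 'a \<Rightarrow> bit) + v = 0 \<longleftrightarrow> u = v"
  by (auto simp: fun_eq_iff)

lemma sum_fun_apply [simp]: "(\<Sum>i\<in>I. f i) x = (\<Sum>i\<in>I. f i x :: bit)"
  by (induction I rule: infinite_finite_induct) auto

lemma vscale_apply [simp]: "vscale c v x = c * v x"
  by (simp add: vscale_def)

text \<open>Cell boundaries are sums over incident cells, whereas codes are defined by sums against
  matrix entries; this passes between the two.\<close>

lemma sum_bit_filter: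
  assumes "finite S"
  shows "(\<Sum>x\<in>{x\<in>S. g x = 1}. f x) = (\<Sum>x\<in>S. g x * f x :: bit)"
proof -
  have "g x * f x = (if g x = 1 then f x else 0)" for x
    by (cases "g x") auto
  then show ?thesis
    using assms by (simp add: sum.inter_filter)
qed

lemma subspace_vspace: "f2.subspace (vspace S)"
  by (auto simp: f2.subspace_def vspace_def)

lemma finite_vspace: "finite S \<Longrightarrow> finite (vspace S)"
  and card_vspace: "finite S \<Longrightarrow> card (vspace S) = 2 ^ card S"
proof -
  assume S: "finite S"
  have "inj_on (\<lambda>T x. if x \<in> T then 1 else 0 :: bit) (Pow S)"
    by (auto simp: inj_on_def fun_eq_iff split: if_splits)
  moreover have "(\<lambda>T x. if x \<in> T then 1 else 0 :: bit) ` Pow S = vspace S"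
  proof (intro equalityI subsetI)
    fix v :: "'a \<Rightarrow> bit" assume "v \<in> vspace S"
    then show "v \<in> (\<lambda>T x. if x \<in> T then 1 else 0) ` Pow S"
      by (intro image_eqI[of _ _ "{x. v x = 1}"]) (auto simp: vspace_def fun_eq_iff)
  qed (auto simp: vspace_def)
  ultimately have "bij_betw (\<lambda>T x. if x \<in> T then 1 else 0 :: bit) (Pow S) (vspace S)"
    by (simp add: bij_betw_def)
  then show "finite (vspace S)" "card (vspace S) = 2 ^ card S"
    using S bij_betw_finite bij_betw_same_card card_Pow by fastforce+
qed

text \<open>The first isomorphism theorem in counted form: the fibres of \<open>f\<close> are cosets
  of \<open>W\<close> and \<open>g\<close> is a section, so each \<open>v\<close> is
  \<open>w + g t\<close> in exactly one way. \<open>T\<close> is a mere set, so that it can later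
  consist of families of codewords.\<close>

lemma card_eq_kernel_times_image:
  assumes W: "f2.subspace W" "W \<subseteq> V" and V: "f2.subspace V"
    and g: "\<And>t. t \<in> T \<Longrightarrow> g t \<in> V \<and> f (g t) = t" and f: "\<And>v. v \<in> V \<Longrightarrow> f v \<in> T"
    and ker: "\<And>u v. u \<in> V \<Longrightarrow> v \<in> V \<Longrightarrow> f u = f v \<longleftrightarrow> u - v \<in> W"
  shows "card V = card W * card T"
proof -
  have "bij_betw (\<lambda>(w, t). w + g t) (W \<times> T) V"
  proof (rule bij_betwI[where g = "\<lambda>v. (v - g (f v), f v)"])
    show "(\<lambda>(w, t). w + g t) \<in> W \<times> T \<rightarrow> V"
      using g V W by (auto intro: f2.subspace_add)
    show "(\<lambda>v. (v - g (f v), f v)) \<in> V \<rightarrow> W \<times> T"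
      using g f ker[THEN iffD1] by fastforce
    fix x assume "x \<in> W \<times> T"
    then obtain w t where x: "x = (w, t)" "w \<in> W" "t \<in> T"
      by auto
    then have "f (w + g t) = f (g t)"
      by (subst ker) (use g V W in \<open>auto intro: f2.subspace_add\<close>)
    then show "(case case x of (w, t) \<Rightarrow> w + g t of v \<Rightarrow> (v - g (f v), f v)) = x"
      using x g by simp
  qed auto
  then show ?thesis
    by (metis bij_betw_same_card card_cartesian_product)
qed

text \<open>The unique coefficients in \<open>quotient_basis\<close> form an additive map with
  kernel \<open>W\<close>, split by linear combinations of \<open>E\<close>. This map plays the role
  of the projection onto \<open>V / W\<close> from here on.\<close>

lemma quotient_basis_coeff:
  assumes "quotient_basis V W E" "f2.subspace V" "f2.subspace W" "W \<subseteq> V"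
  obtains f where "\<And>v. v \<in> V \<Longrightarrow> f v \<in> vspace E"
    "\<And>u v. u \<in> V \<Longrightarrow> v \<in> V \<Longrightarrow> f (u + v) = f u + f v"
    "\<And>v. v \<in> V \<Longrightarrow> f v = 0 \<longleftrightarrow> v \<in> W"
    "\<And>c. c \<in> vspace E \<Longrightarrow> (\<Sum>e\<in>E. vscale (c e) e) \<in> V \<and> f (\<Sum>e\<in>E. vscale (c e) e) = c"
proof -
  define L where "L c = (\<Sum>e\<in>E. vscale (c e) e)" for c
  have E: "E \<subseteq> V" "\<And>v. v \<in> V \<Longrightarrow> \<exists>!c. c \<in> vspace E \<and> v - L c \<in> W"
    using assms(1) by (auto simp: quotient_basis_def L_def)
  define f where "f v = (THE c. c \<in> vspace E \<and> v - L c \<in> W)" for v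
  have f: "f v \<in> vspace E \<and> v - L (f v) \<in> W" if "v \<in> V" for v
    unfolding f_def using E(2)[OF that] by (rule theI')
  have f_eq: "f v = c" if "v \<in> V" "c \<in> vspace E" "v - L c \<in> W" for v c
    using f E(2) that by blast
  have L_add: "L (c + d) = L c + L d" for c d
    by (auto simp: L_def fun_eq_iff algebra_simps sum.distrib)
  have L_0: "L 0 = 0"
    by (auto simp: L_def fun_eq_iff)
  have L_V: "L c \<in> V" for c
    unfolding L_def using E(1) assms(2) by (intro f2.subspace_sum f2.subspace_scale) auto
  show ?thesis
  proof
    fix u v assume uv: "u \<in> V" "v \<in> V"
    have "u + v - L (f u + f v) = (u - L (f u)) + (v - L (f v))"
      by (simp add: L_add)
    also have "\<dots> \<in> W"
      using f uv assms(3) by (intro f2.subspace_add) auto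
    finally show "f (u + v) = f u + f v"
      using f uv by (intro f_eq f2.subspace_add[OF assms(2)] f2.subspace_add[OF subspace_vspace]) auto
  next
    fix v assume v: "v \<in> V"
    show "f v = 0 \<longleftrightarrow> v \<in> W"
      using f[OF v] f_eq[OF v, of 0] f2.subspace_0[OF subspace_vspace] by (auto simp: L_0)
  next
    fix c assume c: "c \<in> vspace E"
    show "(\<Sum>e\<in>E. vscale (c e) e) \<in> V \<and> f (\<Sum>e\<in>E. vscale (c e) e) = c"
      using f_eq[OF L_V c, of c] L_V[of c] f2.subspace_0[OF assms(3)] by (simp add: L_def)
  qed (use f in blast)
qed

lemma card_quotient_basis:
  assumes "quotient_basis V W E" "f2.subspace V" "f2.subspace W" "W \<subseteq> V"
  shows "card V = card W * 2 ^ card E"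
proof -
  obtain f where f: "\<And>v. v \<in> V \<Longrightarrow> f v \<in> vspace E"
    "\<And>u v. u \<in> V \<Longrightarrow> v \<in> V \<Longrightarrow> f (u + v) = f u + f v"
    "\<And>v. v \<in> V \<Longrightarrow> f v = 0 \<longleftrightarrow> v \<in> W"
    "\<And>c. c \<in> vspace E \<Longrightarrow> (\<Sum>e\<in>E. vscale (c e) e) \<in> V \<and> f (\<Sum>e\<in>E. vscale (c e) e) = c"
    by (rule quotient_basis_coeff[OF assms]) (assumption | blast)+
  have "card V = card W * card (vspace E)"
  proof (rule card_eq_kernel_times_image[OF assms(3,4,2) f(4) f(1)])
    fix u v assume uv: "u \<in> V" "v \<in> V"
    have "f (u - v) = 0 \<longleftrightarrow> f u = f v"
      by (simp only: fun_diff_eq_add f(2)[OF uv] fun_add_eq_0_iff)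
    then show "f u = f v \<longleftrightarrow> u - v \<in> W"
      using f(3) f2.subspace_diff[OF assms(2) uv] by blast
  qed auto
  then show ?thesis
    using assms(1) by (simp add: card_vspace quotient_basis_def)
qed

text \<open>If a basis \<open>F\<close> of \<open>W\<close> is extended to a basis \<open>G\<close>
  of \<open>V\<close>, the \<open>F\<close> part of an expansion is exactly what \<open>W\<close>
  absorbs, so the added vectors are a basis modulo \<open>W\<close>.\<close>

lemma quotient_basis_extend:
  assumes F: "f2.independent F" "f2.span F = W" and G: "F \<subseteq> G" "G \<subseteq> V" "f2.independent G" "V \<subseteq> f2.span G"
    and "finite G"
  shows "quotient_basis V W (G - F)"
proof -
  define L where "L T c = (\<Sum>e\<in>T. vscale (c e) e)" for T and c :: "('a \<Rightarrow> bit) \<Rightarrow> bit"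
  have fin: "finite F" "finite (G - F)"
    using assms finite_subset by auto
  have W: "W = range (L F)"
    using f2.span_finite[OF fin(1)] F(2) unfolding L_def by simp
  have split: "L G c = L (G - F) c + L F c" for c
    unfolding L_def using assms by (simp add: sum.subset_diff)
  have "\<exists>!c. c \<in> vspace (G - F) \<and> v - L (G - F) c \<in> W" if "v \<in> V" for v
  proof -
    obtain c where c: "v = L G c"
      using f2.span_finite[OF assms(7)] \<open>v \<in> V\<close> G(4) unfolding L_def by auto
    \<comment> \<open>Coefficient vectors are unique only if they vanish off \<open>G - F\<close>,
      hence the truncation.\<close>
    define c' where "c' e = (if e \<in> G - F then c e else 0)" for e
    have "L (G - F) c' = L (G - F) c"
      unfolding L_def c'_def by (intro sum.cong) auto
    then have ex: "c' \<in> vspace (G - F) \<and> v - L (G - F) c' \<in> W"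
      by (auto simp: c'_def vspace_def c split W)
    have "d = d'" if d: "d \<in> vspace (G - F)" "v - L (G - F) d \<in> W"
      and d': "d' \<in> vspace (G - F)" "v - L (G - F) d' \<in> W" for d d'
    proof -
      obtain k where k: "v - L (G - F) d = L F k"
        using d W by blast
      obtain k' where k': "v - L (G - F) d' = L F k'"
        using d' W by blast
      \<comment> \<open>Two expansions of \<open>v\<close>, by \<open>d\<close> and \<open>k\<close>
        and by \<open>d'\<close> and \<open>k'\<close>, differ by a vanishing combination of
        \<open>G\<close>; its coefficients are \<open>h\<close>.\<close>
      define h where "h e = (if e \<in> F then k e - k' e else d e - d' e)" for e
      have "L F h = L F k - L F k'"
        unfolding L_def sum_subtractf[symmetric] h_def by (intro sum.cong) (auto simp: fun_eq_iff algebra_simps)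
      moreover have "L (G - F) h = L (G - F) d - L (G - F) d'"
        unfolding L_def sum_subtractf[symmetric] h_def by (intro sum.cong) (auto simp: fun_eq_iff algebra_simps)
      ultimately have "L G h = 0"
        unfolding split by (simp add: k[symmetric] k'[symmetric])
      then have "h e = 0" if "e \<in> G" for e
        using f2.independentD[OF G(3) assms(7) order_refl] that unfolding L_def by blast
      then have "d e = d' e" if "e \<in> G - F" for e
        using that by (force simp: h_def)
      moreover have "d e = d' e" if "e \<notin> G - F" for e
        using d(1) d'(1) that unfolding vspace_def by fastforce
      ultimately show "d = d'"
        by blast
    qed
    with ex show ?thesis
      by blast
  qed
  then show ?thesis
    using G fin by (auto simp: quotient_basis_def L_def)
qed

lemma ex_quotient_basis:
  assumes "f2.subspace W" "W \<subseteq> V" "finite V"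
  shows "\<exists>E. quotient_basis V W E"
proof -
  obtain F where F: "F \<subseteq> W" "f2.independent F" "W \<subseteq> f2.span F"
    using f2.maximal_independent_subset by blast
  then have "f2.span F = W"
    using assms f2.span_minimal by blast
  moreover obtain G where "F \<subseteq> G" "G \<subseteq> V" "f2.independent G" "V \<subseteq> f2.span G"
    using f2.maximal_independent_subset_extend[of F V] F assms by blast
  ultimately show ?thesis
    using quotient_basis_extend F assms finite_subset by metis
qed

text \<open>The finite set \<open>W\<close> contains 0, so the factor \<open>card W\<close> cancels
  and all quotient bases have the same size; this makes the definite description in
  \<open>quotient_dim\<close> meaningful.\<close>

lemma quotient_dim_eqI:
  assumes "quotient_basis V W E" "f2.subspace V" "f2.subspace W" "W \<subseteq> V" "finite V"
  shows "quotient_dim V W = card E"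
proof -
  have W: "card W > 0"
    using assms f2.subspace_0 finite_subset by (metis card_gt_0_iff empty_iff)
  have "card E' = card E" if "quotient_basis V W E'" for E'
  proof -
    have "card W * 2 ^ card E' = card W * 2 ^ card E"
      using card_quotient_basis that assms by metis
    then show ?thesis
      using W by simp
  qed
  then show ?thesis
    unfolding quotient_dim_def using assms(1) by (intro the_equality) blast+
qed

lemma card_quotient_dim:
  assumes "f2.subspace V" "f2.subspace W" "W \<subseteq> V" "finite V"
  shows "card V = card W * 2 ^ quotient_dim V W"
  using ex_quotient_basis[OF assms(2,3,4)] quotient_dim_eqI card_quotient_basis assms by metis

text \<open>A basis of \<open>V\<close> is a quotient basis modulo the zero space, obtained by
  extending the empty basis.\<close>

lemma card_subspace:
  assumes "f2.subspace V" "finite V"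
  shows "card V = 2 ^ f2.dim V"
proof -
  obtain G where G: "G \<subseteq> V" "f2.independent G" "V \<subseteq> f2.span G" "card G = f2.dim V"
    using f2.basis_exists by blast
  have "quotient_basis V {0} (G - {})"
    using G assms f2.independent_empty by (intro quotient_basis_extend) (auto intro: finite_subset)
  then have "card V = card {0 :: 'a \<Rightarrow> bit} * 2 ^ card G"
    using card_quotient_basis[of V "{0}" G] assms f2.subspace_0 f2.subspace_single_0 by auto
  then show ?thesis
    using G by simp
qed

text \<open>Used in the contrapositive: a code of nonzero dimension has a cycle that is not a
  boundary.\<close>

lemma quotient_dim_self:
  assumes "f2.subspace V" "finite V"
  shows "quotient_dim V V = 0"
proof -
  have "card V > 0"
    using assms f2.subspace_0 by (metis card_gt_0_iff empty_iff)
  then show ?thesis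
    using card_quotient_dim[OF assms(1,1) order_refl assms(2)]
    by (cases "quotient_dim V V") auto
qed

subsection \<open>Matrices and codes\<close>

lemma subspace_classical_code: "f2.subspace (classical_code R S M)"
  by (auto simp: f2.subspace_def classical_code_def vspace_def algebra_simps sum.distrib
      mult.left_commute[of _ "_ :: bit"] simp flip: sum_distrib_left)

lemma subspace_row_space: "f2.subspace (row_space R S M)"
  by (simp add: row_space_def)

lemma mem_row_space:
  assumes "finite R"
  shows "v \<in> row_space R S M \<longleftrightarrow> v \<in> vspace S \<and> (\<exists>c. \<forall>s\<in>S. v s = (\<Sum>r\<in>R. c r * M r s))"
    (is "?lhs \<longleftrightarrow> ?rhs")
proof
  let ?U = "{v. v \<in> vspace S \<and> (\<exists>c. \<forall>s\<in>S. v s = (\<Sum>r\<in>R. c r * M r s))}"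
  have "matrix_row S M r \<in> ?U" if "r \<in> R" for r
    using that assms by (auto simp: matrix_row_def vspace_def if_distrib[where f = "\<lambda>x. x * _"] cong: if_cong
        intro!: exI[of _ "\<lambda>r'. if r = r' then 1 else 0"])
  moreover have "f2.subspace ?U"
  proof (rule f2.subspaceI)
    show "0 \<in> ?U"
      by (auto simp: vspace_def intro!: exI[of _ 0])
    fix u v assume "u \<in> ?U" "v \<in> ?U"
    then obtain c d where "\<forall>s\<in>S. u s = (\<Sum>r\<in>R. c r * M r s)" "\<forall>s\<in>S. v s = (\<Sum>r\<in>R. d r * M r s)"
      by auto
    then show "u + v \<in> ?U"
      using \<open>u \<in> ?U\<close> \<open>v \<in> ?U\<close>
      by (auto simp: vspace_def algebra_simps sum.distrib intro!: exI[of _ "c + d"])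
  next
    fix k u assume "u \<in> ?U"
    then obtain c where "\<forall>s\<in>S. u s = (\<Sum>r\<in>R. c r * M r s)"
      by auto
    then show "vscale k u \<in> ?U"
      using \<open>u \<in> ?U\<close>
      by (auto simp: vspace_def algebra_simps sum_distrib_left intro!: exI[of _ "vscale k c"])
  qed
  ultimately have "row_space R S M \<subseteq> ?U"
    unfolding row_space_def by (intro f2.span_minimal) auto
  then show "?rhs" if "?lhs"
    using that by blast
next
  assume "?rhs"
  then obtain c where v: "v \<in> vspace S" "\<forall>s\<in>S. v s = (\<Sum>r\<in>R. c r * M r s)"
    by auto
  have "v s = (\<Sum>r\<in>R. vscale (c r) (matrix_row S M r)) s" for s
    using v by (cases "s \<in> S") (auto simp: fun_eq_iff matrix_row_def vspace_def)
  then have "v = (\<Sum>r\<in>R. vscale (c r) (matrix_row S M r))"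
    by (rule ext)
  then show "?lhs"
    unfolding row_space_def by (simp only:) (intro f2.span_sum f2.span_scale f2.span_base imageI)
qed

text \<open>Orthogonality to the generators of a span suffices, so the cycle and cocycle spaces are
  solution sets of parity checks.\<close>

lemma orth_compl_row_space:
  assumes "finite R"
  shows "orth_compl S (row_space R S M) = classical_code R S M"
proof (intro equalityI subsetI)
  fix v assume v: "v \<in> orth_compl S (row_space R S M)"
  have "(\<Sum>s\<in>S. M r s * v s) = 0" if "r \<in> R" for r
  proof -
    have "matrix_row S M r \<in> row_space R S M"
      using that by (auto simp: row_space_def intro: f2.span_base)
    then have "(\<Sum>s\<in>S. v s * matrix_row S M r s) = 0"
      using v by (auto simp: orth_compl_def)
    then show ?thesis
      by (simp add: matrix_row_def mult.commute)
  qed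
  then show "v \<in> classical_code R S M"
    using v by (auto simp: orth_compl_def classical_code_def)
next
  fix v assume v: "v \<in> classical_code R S M"
  have "(\<Sum>s\<in>S. v s * w s) = 0" if "w \<in> row_space R S M" for w
  proof -
    obtain c where "\<forall>s\<in>S. w s = (\<Sum>r\<in>R. c r * M r s)"
      using mem_row_space[OF assms] \<open>w \<in> _\<close> by metis
    then have "(\<Sum>s\<in>S. v s * w s) = (\<Sum>s\<in>S. \<Sum>r\<in>R. c r * (M r s * v s))"
      by (auto simp: sum_distrib_left ac_simps intro!: sum.cong)
    also have "\<dots> = (\<Sum>r\<in>R. c r * (\<Sum>s\<in>S. M r s * v s))"
      by (subst sum.swap) (simp add: sum_distrib_left)
    also have "\<dots> = 0"
      using v by (auto simp: classical_code_def)
    finally show ?thesis .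
  qed
  then show "v \<in> orth_compl S (row_space R S M)"
    using v by (auto simp: orth_compl_def classical_code_def)
qed

lemma finite_classical_code: "finite S \<Longrightarrow> finite (classical_code R S M)"
  by (rule finite_subset[OF _ finite_vspace]) (auto simp: classical_code_def)

text \<open>A basis chosen among the rows has \<open>card B\<close> elements, so it consists of all
  rows, and no two of them coincide. Independent vectors can be mapped linearly to any targets, here
  to unit vectors.\<close>

lemma full_row_rank_imp_right_inverse:
  assumes "finite A" "finite B" "matrix_rank B A H = card B"
  obtains S where "\<And>b b'. b \<in> B \<Longrightarrow> (\<Sum>a\<in>A. H b a * S a b') = (if b' = b then 1 else 0)"
proof -
  let ?r = "matrix_row A H"
  have dim: "f2.dim (?r ` B) = card B"
    using assms(3) by (simp add: matrix_rank_def row_space_def)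
  obtain G where G: "G \<subseteq> ?r ` B" "f2.independent G" "card G = f2.dim (?r ` B)"
    using f2.basis_exists by metis
  then have "G = ?r ` B"
    using assms(2) dim card_image_le[of B ?r] by (intro card_seteq) auto
  then have ind: "f2.independent (?r ` B)" and inj: "inj_on ?r B"
    using G dim assms(2) by (auto intro: eq_card_imp_inj_on)
  interpret pair: vector_space_pair "vscale :: _ \<Rightarrow> ('a \<Rightarrow> bit) \<Rightarrow> _" "vscale :: _ \<Rightarrow> ('b \<Rightarrow> bit) \<Rightarrow> _"
    by unfold_locales
  \<comment> \<open>The equation \<open>g (row b) = unit_vec b\<close>, with the row expanded in
    unit vectors, reads \<open>H S = 1\<close>, where row \<open>a\<close> of \<open>S\<close> is
    \<open>g (unit_vec a)\<close>.\<close>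
  obtain g where g: "Vector_Spaces.linear vscale vscale g"
    "\<And>b. b \<in> B \<Longrightarrow> g (?r b) = unit_vec b"
    using pair.linear_independent_extend[OF ind, of "\<lambda>v. unit_vec (inv_into B ?r v)"] inj by auto
  interpret g: Vector_Spaces.linear vscale vscale g
    by (rule g)
  show ?thesis
  proof
    fix b b' assume b: "b \<in> B"
    have "?r b = (\<Sum>a\<in>A. vscale (H b a) (unit_vec a))"
      using assms(1) by (auto simp: fun_eq_iff matrix_row_def unit_vec_def if_distrib cong: if_cong)
    then have "unit_vec b = (\<Sum>a\<in>A. vscale (H b a) (g (unit_vec a)))"
      using g(2)[OF b] by (simp add: g.sum g.scale)
    then show "(\<Sum>a\<in>A. H b a * g (unit_vec a) b') = (if b' = b then 1 else 0)"
      by (simp add: fun_eq_iff unit_vec_def)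
  qed
qed

text \<open>The associativity \<open>u (M v) = (u M) v\<close>; most matrix manipulations below are
  instances of it, after commuting factors into this order.\<close>

lemma sum_mult_swap:
  "(\<Sum>x\<in>S. f x * (\<Sum>y\<in>T. g x y * h y)) = (\<Sum>y\<in>T. (\<Sum>x\<in>S. f x * g x y) * h y :: bit)"
  by (simp add: sum_distrib_left sum_distrib_right mult.assoc) (rule sum.swap)

text \<open>This makes \<open>HX\<close> and \<open>HZ\<close> describe the boundary maps
  completely. Linearity is only given on \<open>vspace S\<close>, so the induction runs over subsets
  of \<open>S\<close>, where all partial sums stay inside that space.\<close>

lemma linear_map_eq_sum:
  assumes "linear_map S T f" "finite S" "v \<in> vspace S"
  shows "f v = (\<Sum>x\<in>S. vscale (v x) (f (unit_vec x)))"
proof -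
  have unit: "unit_vec x \<in> vspace S" if "x \<in> S" for x
    using that by (auto simp: unit_vec_def vspace_def)
  have f0: "f 0 = 0"
  proof -
    have "0 \<in> vspace S"
      by (simp add: vspace_def)
    then have "f (vscale 0 0) = vscale 0 (f 0)"
      using assms(1) unfolding linear_map_def by blast
    then show ?thesis
      by (simp add: f2.scale_zero_left)
  qed
  have "f (\<Sum>x\<in>F. vscale (v x) (unit_vec x)) = (\<Sum>x\<in>F. vscale (v x) (f (unit_vec x)))"
    if "F \<subseteq> S" for F
    using finite_subset[OF that assms(2)] that
  proof (induction F)
    case (insert x F)
    have "vscale (v x) (unit_vec x) \<in> vspace S" "(\<Sum>x\<in>F. vscale (v x) (unit_vec x)) \<in> vspace S"
      using insert.prems unit
      by (auto intro!: f2.subspace_scale[OF subspace_vspace] f2.subspace_sum[OF subspace_vspace])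
    then have "f (vscale (v x) (unit_vec x) + (\<Sum>x\<in>F. vscale (v x) (unit_vec x))) =
        vscale (v x) (f (unit_vec x)) + f (\<Sum>x\<in>F. vscale (v x) (unit_vec x))"
      using assms(1) unit insert.prems unfolding linear_map_def by (metis insert_subset)
    moreover have "f (\<Sum>x\<in>F. vscale (v x) (unit_vec x)) = (\<Sum>x\<in>F. vscale (v x) (f (unit_vec x)))"
      using insert by blast
    ultimately show ?case
      by (simp only: sum.insert[OF insert.hyps])
  qed (simp add: f0)
  moreover have "v = (\<Sum>x\<in>S. vscale (v x) (unit_vec x))"
    using assms(2,3) by (auto simp: fun_eq_iff unit_vec_def vspace_def if_distrib cong: if_cong)
  ultimately show ?thesis
    by (metis order_refl)
qed

lemma linear_map_linear_extension:
  assumes "\<And>x. x \<in> S \<Longrightarrow> f x \<in> vspace T"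
  shows "linear_map S T (linear_extension S f)"
  unfolding linear_map_def
proof (intro conjI ballI allI)
  show "linear_extension S f v \<in> vspace T" for v
    unfolding linear_extension_def
    using assms by (intro f2.subspace_sum f2.subspace_scale subspace_vspace)
qed (auto simp: linear_extension_def fun_eq_iff algebra_simps sum.distrib sum_distrib_left)

lemma linear_extension_unit_vec:
  assumes "finite S" "x \<in> S"
  shows "linear_extension S f (unit_vec x) = f x"
  using assms by (auto simp: linear_extension_def fun_eq_iff unit_vec_def if_distrib[where f = "\<lambda>c. c * _"] cong: if_cong)

lemma Inl_mem_Plus_iff [simp]: "Inl x \<in> S <+> T \<longleftrightarrow> x \<in> S"
  and Inr_mem_Plus_iff [simp]: "Inr y \<in> S <+> T \<longleftrightarrow> y \<in> T"
  by auto

lemma finite_weights: "finite S \<Longrightarrow> V \<subseteq> vspace S \<Longrightarrow> finite (hamming_weight ` V)"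
  using finite_subset finite_vspace by blast

lemma finite_support: "finite S \<Longrightarrow> v \<in> vspace S \<Longrightarrow> finite {x. v x \<noteq> 0}"
  by (erule rev_finite_subset) (auto simp: vspace_def)

text \<open>The distance of two codewords is the weight of their difference, which is again a
  codeword.\<close>

lemma min_distance_eq_min_weight:
  assumes "f2.subspace C"
  shows "min_distance C = Min (hamming_weight ` (C - {0}))"
proof -
  have eq: "hamming_dist u v = hamming_weight (u - v)" for u v :: "'a \<Rightarrow> bit"
    by (simp add: hamming_dist_def hamming_weight_def)
  have "{hamming_dist u v | u v. u \<in> C \<and> v \<in> C \<and> u \<noteq> v} = hamming_weight ` (C - {0})"
  proof (intro equalityI subsetI)
    fix n assume "n \<in> {hamming_dist u v | u v. u \<in> C \<and> v \<in> C \<and> u \<noteq> v}"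
    then show "n \<in> hamming_weight ` (C - {0})"
      unfolding eq using f2.subspace_diff[OF assms] by fastforce
  next
    fix n assume "n \<in> hamming_weight ` (C - {0})"
    then obtain v where v: "v \<in> C" "v \<noteq> 0" "n = hamming_weight v"
      by blast
    then have "n = hamming_dist v 0"
      unfolding eq by simp
    then show "n \<in> {hamming_dist u v | u v. u \<in> C \<and> v \<in> C \<and> u \<noteq> v}"
      using v f2.subspace_0[OF assms] by blast
  qed
  then show ?thesis
    by (simp add: min_distance_def)
qed

subsection \<open>The product complex\<close>

locale finite_chain_complex =
  fixes X :: "('p, 'q, 'r) cell_complex"
  assumes chain: "chain_complex2 X"
begin

lemma finite_cells: "finite (cells0 X)" "finite (cells1 X)" "finite (cells2 X)"
  using chain by (auto simp: chain_complex2_def)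

lemma CX_eq: "CX X = classical_code (cells0 X) (cells1 X) (HX X)"
  and CZ_eq: "CZ X = classical_code (cells2 X) (cells1 X) (HZ X)"
  by (simp_all add: CX_def CZ_def WX_def WZ_def orth_compl_row_space finite_cells)

lemma subspaces: "f2.subspace (CX X)" "f2.subspace (CZ X)" "f2.subspace (WX X)" "f2.subspace (WZ X)"
  by (simp_all add: CX_eq CZ_eq WX_def WZ_def subspace_classical_code subspace_row_space)

lemma mem_CX: "v \<in> CX X \<longleftrightarrow> v \<in> vspace (cells1 X) \<and> (\<forall>p\<in>cells0 X. (\<Sum>q\<in>cells1 X. HX X p q * v q) = 0)"
  and mem_CZ: "v \<in> CZ X \<longleftrightarrow> v \<in> vspace (cells1 X) \<and> (\<forall>r\<in>cells2 X. (\<Sum>q\<in>cells1 X. HZ X r q * v q) = 0)"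
  by (auto simp: CX_eq CZ_eq classical_code_def)

lemma mem_WX: "v \<in> WX X \<longleftrightarrow> v \<in> vspace (cells1 X) \<and>
    (\<exists>c. \<forall>q\<in>cells1 X. v q = (\<Sum>p\<in>cells0 X. c p * HX X p q))"
  and mem_WZ: "v \<in> WZ X \<longleftrightarrow> v \<in> vspace (cells1 X) \<and>
    (\<exists>c. \<forall>q\<in>cells1 X. v q = (\<Sum>r\<in>cells2 X. c r * HZ X r q))"
  by (simp_all add: WX_def WZ_def mem_row_space finite_cells)

lemma finite_CX: "finite (CX X)"
  by (simp add: CX_eq finite_classical_code finite_cells)

text \<open>This is the entry at \<open>p\<close> of the vanishing double boundary of the cell
  \<open>r\<close>.\<close>

lemma HX_HZ_orthogonal:
  assumes "r \<in> cells2 X"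
  shows "(\<Sum>q\<in>cells1 X. HX X p q * HZ X r q) = 0"
proof -
  have unit: "unit_vec r \<in> vspace (cells2 X)"
    using assms by (auto simp: unit_vec_def vspace_def)
  have "0 = bd1 X (bd2 X (unit_vec r)) p"
    using chain unit by (simp add: chain_complex2_def)
  also have "\<dots> = (\<Sum>q\<in>cells1 X. bd2 X (unit_vec r) q * bd1 X (unit_vec q) p)"
    using chain unit
    by (subst linear_map_eq_sum[of "cells1 X" "cells0 X"]) (auto simp: chain_complex2_def linear_map_def)
  finally show ?thesis
    by (simp add: HX_def HZ_def mult.commute)
qed

lemma WZ_subset_CX: "WZ X \<subseteq> CX X"
proof
  fix v assume "v \<in> WZ X"
  then obtain c where v: "v \<in> vspace (cells1 X)" "\<forall>q\<in>cells1 X. v q = (\<Sum>r\<in>cells2 X. HZ X r q * c r)"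
    by (auto simp: mem_WZ mult.commute)
  then have "(\<Sum>q\<in>cells1 X. HX X p q * v q) = 0" for p
    by (simp add: sum_mult_swap HX_HZ_orthogonal)
  then show "v \<in> CX X"
    using v by (simp add: mem_CX)
qed

lemma CX_ne_WZ:
  assumes "css_dim X \<noteq> 0"
  shows "CX X - WZ X \<noteq> {}"
  using assms quotient_dim_self[OF subspaces(1) finite_CX] WZ_subset_CX
  by (auto simp: css_dim_def)

end

section \<open>Incidence matrices of the product complex and its cycle and boundary
  conditions\<close>

locale product_code = finite_chain_complex X
  for X :: "('p, 'q, 'r) cell_complex" +
  fixes A :: "'a set" and B :: "'b set" and H :: "'b \<Rightarrow> 'a \<Rightarrow> bit"
  assumes finite_A: "finite A" and finite_B: "finite B"
begin

abbreviation "Q \<equiv> product_complex X B A H"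

lemma cells_Q:
  "cells0 Q = (cells0 X \<times> A) <+> (cells1 X \<times> B)"
  "cells1 Q = (cells1 X \<times> A) <+> (cells2 X \<times> B)"
  "cells2 Q = cells2 X \<times> A"
  by (simp_all add: product_complex_def)

lemma finite_cells_Q: "finite (cells0 Q)" "finite (cells1 Q)" "finite (cells2 Q)"
  using finite_cells finite_A finite_B by (simp_all add: cells_Q)

lemma HX_Q_eq_cell: "y \<in> cells1 Q \<Longrightarrow> HX Q x y = product_bd1_cell X B H y x"
  using finite_cells_Q by (simp add: HX_def product_complex_def linear_extension_unit_vec)

lemma HZ_Q_eq_cell: "z \<in> cells2 Q \<Longrightarrow> HZ Q z y = product_bd2_cell X B H z y"
  using finite_cells_Q by (simp add: HZ_def product_complex_def linear_extension_unit_vec)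

text \<open>The left block column of \<open>HX Q\<close>, whose block rows are
  \<open>(HX * 1, 0)\<close> and \<open>(1 * H, HZ^T * 1)\<close> with \<open>*\<close> the
  Kronecker product; likewise \<open>HZ Q\<close> is \<open>(HZ * 1, 1 * H^T)\<close>. Row indices
  range over the whole type, so that these entries also show that boundaries vanish outside
  \<open>cells0 Q\<close>.\<close>

lemma HX_Q:
  assumes "q \<in> cells1 X" "a \<in> A"
  shows "HX Q (Inl (p, a')) (Inl (q, a)) = (if a' = a \<and> p \<in> cells0 X then HX X p q else 0)"
    and "HX Q (Inr (q', b)) (Inl (q, a)) = (if q' = q \<and> b \<in> B then H b a else 0)"
  using assms finite_cells finite_B
  by (auto simp: HX_Q_eq_cell cells_Q sum_bit_filter unit_vec_def if_distrib cong: if_cong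
      intro!: sum.neutral)

lemma HX_Q':
  assumes "r \<in> cells2 X" "b \<in> B"
  shows "HX Q (Inl (p, a')) (Inr (r, b)) = 0"
    and "HX Q (Inr (q, b')) (Inr (r, b)) = (if b' = b \<and> q \<in> cells1 X then HZ X r q else 0)"
  using assms finite_cells finite_B
  by (auto simp: HX_Q_eq_cell cells_Q sum_bit_filter unit_vec_def if_distrib cong: if_cong
      intro!: sum.neutral)

lemma HZ_Q:
  assumes "r \<in> cells2 X" "a \<in> A"
  shows "HZ Q (r, a) (Inl (q, a')) = (if a' = a \<and> q \<in> cells1 X then HZ X r q else 0)"
    and "HZ Q (r, a) (Inr (r', b)) = (if r' = r \<and> b \<in> B then H b a else 0)"
  using assms finite_cells finite_B
  by (auto simp: HZ_Q_eq_cell cells_Q sum_bit_filter unit_vec_def if_distrib cong: if_cong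
      intro!: sum.neutral)

lemma sum_cells0_Q: "(\<Sum>x\<in>cells0 Q. f x) =
    (\<Sum>p\<in>cells0 X. \<Sum>a\<in>A. f (Inl (p, a))) + (\<Sum>q\<in>cells1 X. \<Sum>b\<in>B. f (Inr (q, b)) :: bit)"
  and sum_cells1_Q: "(\<Sum>y\<in>cells1 Q. f' y) =
    (\<Sum>q\<in>cells1 X. \<Sum>a\<in>A. f' (Inl (q, a))) + (\<Sum>r\<in>cells2 X. \<Sum>b\<in>B. f' (Inr (r, b)) :: bit)"
  and sum_cells2_Q: "(\<Sum>z\<in>cells2 Q. f'' z) = (\<Sum>r\<in>cells2 X. \<Sum>a\<in>A. f'' (r, a) :: bit)"
  using finite_cells finite_A finite_B
  by (simp_all add: cells_Q sum.Plus sum.cartesian_product)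

lemma sum_HX_Q:
  assumes "a \<in> A" "p \<in> cells0 X"
  shows "(\<Sum>y\<in>cells1 Q. HX Q (Inl (p, a)) y * v y) = (\<Sum>q\<in>cells1 X. HX X p q * v (Inl (q, a)))"
  using assms finite_A finite_B
  by (simp add: sum_cells1_Q HX_Q HX_Q' if_distrib[where f = "\<lambda>c. c * _"] cong: sum.cong_simp if_cong)

lemma sum_HX_Q':
  assumes "b \<in> B" "q \<in> cells1 X"
  shows "(\<Sum>y\<in>cells1 Q. HX Q (Inr (q, b)) y * v y) =
    (\<Sum>a\<in>A. H b a * v (Inl (q, a))) + (\<Sum>r\<in>cells2 X. HZ X r q * v (Inr (r, b)))"
proof -
  have "(\<Sum>q'\<in>cells1 X. \<Sum>a\<in>A. HX Q (Inr (q, b)) (Inl (q', a)) * v (Inl (q', a))) =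
    (\<Sum>q'\<in>cells1 X. if q = q' then (\<Sum>a\<in>A. H b a * v (Inl (q', a))) else 0)"
    using assms by (intro sum.cong) (auto simp: HX_Q intro!: sum.neutral)
  moreover have "(\<Sum>r\<in>cells2 X. \<Sum>b'\<in>B. HX Q (Inr (q, b)) (Inr (r, b')) * v (Inr (r, b'))) =
    (\<Sum>r\<in>cells2 X. HZ X r q * v (Inr (r, b)))"
    using assms finite_B
    by (intro sum.cong) (simp_all add: HX_Q' if_distrib[where f = "\<lambda>c. c * _"] cong: sum.cong_simp if_cong)
  ultimately show ?thesis
    using assms finite_cells by (simp add: sum_cells1_Q)
qed

lemma sum_HZ_Q:
  assumes "r \<in> cells2 X" "a \<in> A"
  shows "(\<Sum>y\<in>cells1 Q. HZ Q (r, a) y * v y) =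
    (\<Sum>q\<in>cells1 X. HZ X r q * v (Inl (q, a))) + (\<Sum>b\<in>B. H b a * v (Inr (r, b)))"
proof -
  have "(\<Sum>r'\<in>cells2 X. \<Sum>b\<in>B. HZ Q (r, a) (Inr (r', b)) * v (Inr (r', b))) =
    (\<Sum>r'\<in>cells2 X. if r = r' then (\<Sum>b\<in>B. H b a * v (Inr (r', b))) else 0)"
    using assms by (intro sum.cong) (auto simp: HZ_Q intro!: sum.neutral)
  moreover have "(\<Sum>q\<in>cells1 X. \<Sum>a'\<in>A. HZ Q (r, a) (Inl (q, a')) * v (Inl (q, a'))) =
    (\<Sum>q\<in>cells1 X. HZ X r q * v (Inl (q, a)))"
    using assms finite_A
    by (intro sum.cong) (simp_all add: HZ_Q if_distrib[where f = "\<lambda>c. c * _"] cong: sum.cong_simp if_cong)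
  ultimately show ?thesis
    using assms finite_cells by (simp add: sum_cells1_Q)
qed

lemma chain_complex2_Q: "chain_complex2 Q"
proof -
  have "product_bd1_cell X B H y \<in> vspace (cells0 Q)" if "y \<in> cells1 Q" for y
    using that unfolding vspace_def cells_Q
    by (auto simp: split_sum_all HX_Q HX_Q' cells_Q simp flip: HX_Q_eq_cell)
  then have 1: "linear_map (cells1 Q) (cells0 Q) (bd1 Q)"
    using linear_map_linear_extension[of "cells1 Q" "product_bd1_cell X B H" "cells0 Q"] by (simp add: product_complex_def)
  have "product_bd2_cell X B H z \<in> vspace (cells1 Q)" if "z \<in> cells2 Q" for z
    using that unfolding vspace_def cells_Q
    by (auto simp: split_sum_all HZ_Q cells_Q simp flip: HZ_Q_eq_cell)
  then have 2: "linear_map (cells2 Q) (cells1 Q) (bd2 Q)"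
    using linear_map_linear_extension[of "cells2 Q" "product_bd2_cell X B H" "cells1 Q"] by (simp add: product_complex_def)
  have "bd1 Q (bd2 Q v) = 0" if v: "v \<in> vspace (cells2 Q)" for v
  proof -
    have bd2: "bd2 Q v = (\<Sum>z\<in>cells2 Q. vscale (v z) (bd2 Q (unit_vec z)))"
      using linear_map_eq_sum[OF 2] v finite_cells_Q by blast
    have orth: "(\<Sum>y\<in>cells1 Q. HX Q x y * HZ Q z y) = 0" if x: "x \<in> cells0 Q" and z: "z \<in> cells2 Q" for x z
    proof -
      obtain r a where z': "z = (r, a)" "r \<in> cells2 X" "a \<in> A"
        using z by (auto simp: cells_Q)
      consider p a' where "x = Inl (p, a')" "p \<in> cells0 X" "a' \<in> A"
        | q b where "x = Inr (q, b)" "q \<in> cells1 X" "b \<in> B"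
        using x by (auto simp: cells_Q)
      then show ?thesis
      proof cases
        case 1
        then show ?thesis
          using z' HX_HZ_orthogonal[of r p] by (cases "a = a'") (simp_all add: sum_HX_Q HZ_Q)
      next
        \<comment> \<open>The cell \<open>(r, a)\<close> reaches \<open>(q, b)\<close> by two paths,
          through \<open>(q, a)\<close> and through \<open>(r, b)\<close>. Both contribute
          \<open>H b a * HZ X r q\<close> and cancel.\<close>
        case 2
        then show ?thesis
          using z' finite_A finite_cells
          by (simp add: sum_HX_Q' HZ_Q if_distrib[where f = "\<lambda>c. _ * c"] cong: if_cong)
      qed
    qed
    have "bd1 Q (bd2 Q v) x = 0" for x
    proof (cases "x \<in> cells0 Q")
      case True
      have "bd2 Q v \<in> vspace (cells1 Q)"
        using 2 v by (simp add: linear_map_def)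
      then have "bd1 Q (bd2 Q v) x = (\<Sum>y\<in>cells1 Q. HX Q x y * bd2 Q v y)"
        using linear_map_eq_sum[OF 1] finite_cells_Q by (simp add: HX_def mult.commute)
      also have "\<dots> = (\<Sum>y\<in>cells1 Q. HX Q x y * (\<Sum>z\<in>cells2 Q. HZ Q z y * v z))"
        by (simp add: bd2 HZ_def mult.commute)
      also have "\<dots> = 0"
        unfolding sum_mult_swap using orth True by simp
      finally show ?thesis .
    next
      case False
      then show ?thesis
        using 1 2 v by (auto simp: linear_map_def vspace_def)
    qed
    then show ?thesis
      by (simp add: fun_eq_iff)
  qed
  with 1 2 show ?thesis
    using finite_cells_Q by (simp add: chain_complex2_def)
qed

sublocale Q: finite_chain_complex Q
  by unfold_locales (rule chain_complex2_Q)

lemma vspace_Q: "v \<in> vspace (cells1 Q) \<Longrightarrow> (\<lambda>q. v (Inl (q, a))) \<in> vspace (cells1 X)"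
  by (auto simp: vspace_def cells_Q)

text \<open>In the second condition the right-hand side is the boundary of the 2-chain
  \<open>v (Inr (_, b))\<close>. Hence every check of \<open>H\<close>, applied to the rows, gives a
  boundary, which is what puts the coordinates of the row classes into \<open>C\<close>.\<close>

lemma mem_CX_Q: "v \<in> CX Q \<longleftrightarrow> v \<in> vspace (cells1 Q) \<and>
    (\<forall>p\<in>cells0 X. \<forall>a\<in>A. (\<Sum>q\<in>cells1 X. HX X p q * v (Inl (q, a))) = 0) \<and>
    (\<forall>q\<in>cells1 X. \<forall>b\<in>B. (\<Sum>a\<in>A. H b a * v (Inl (q, a))) = (\<Sum>r\<in>cells2 X. HZ X r q * v (Inr (r, b))))"
proof -
  have "(\<forall>x\<in>cells0 Q. P x) \<longleftrightarrow> (\<forall>p\<in>cells0 X. \<forall>a\<in>A. P (Inl (p, a))) \<and> (\<forall>q\<in>cells1 X. \<forall>b\<in>B. P (Inr (q, b)))" for P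
    by (auto simp: cells_Q)
  then show ?thesis
    by (simp add: Q.mem_CX sum_HX_Q sum_HX_Q')
qed

lemma mem_CZ_Q: "v \<in> CZ Q \<longleftrightarrow> v \<in> vspace (cells1 Q) \<and>
    (\<forall>r\<in>cells2 X. \<forall>a\<in>A. (\<Sum>q\<in>cells1 X. HZ X r q * v (Inl (q, a))) = (\<Sum>b\<in>B. H b a * v (Inr (r, b))))"
proof -
  have "(\<forall>z\<in>cells2 Q. P z) \<longleftrightarrow> (\<forall>r\<in>cells2 X. \<forall>a\<in>A. P (r, a))" for P
    by (auto simp: cells_Q)
  then show ?thesis
    by (simp add: Q.mem_CZ sum_HZ_Q)
qed

lemma ball_cells1_Q: "(\<forall>y\<in>cells1 Q. P y) \<longleftrightarrow>
    (\<forall>q\<in>cells1 X. \<forall>a\<in>A. P (Inl (q, a))) \<and> (\<forall>r\<in>cells2 X. \<forall>b\<in>B. P (Inr (r, b)))"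
  by (auto simp: cells_Q)

lemma mem_WZ_Q: "v \<in> WZ Q \<longleftrightarrow> v \<in> vspace (cells1 Q) \<and> (\<exists>c.
    (\<forall>q\<in>cells1 X. \<forall>a\<in>A. v (Inl (q, a)) = (\<Sum>r\<in>cells2 X. c (r, a) * HZ X r q)) \<and>
    (\<forall>r\<in>cells2 X. \<forall>b\<in>B. v (Inr (r, b)) = (\<Sum>a\<in>A. c (r, a) * H b a)))"
proof -
  have "(\<Sum>z\<in>cells2 Q. c z * HZ Q z (Inl (q, a))) = (\<Sum>r\<in>cells2 X. c (r, a) * HZ X r q)"
    if "q \<in> cells1 X" "a \<in> A" for c q a
    using that finite_A
    by (simp add: sum_cells2_Q HZ_Q if_distrib[where f = "\<lambda>c. _ * c"] cong: sum.cong_simp if_cong)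
  moreover have "(\<Sum>z\<in>cells2 Q. c z * HZ Q z (Inr (r, b))) = (\<Sum>a\<in>A. c (r, a) * H b a)"
    if "r \<in> cells2 X" "b \<in> B" for c r b
  proof -
    have "(\<Sum>z\<in>cells2 Q. c z * HZ Q z (Inr (r, b))) =
      (\<Sum>r'\<in>cells2 X. if r = r' then \<Sum>a\<in>A. c (r', a) * H b a else 0)"
      unfolding sum_cells2_Q using that by (intro sum.cong) (auto simp: HZ_Q intro!: sum.neutral)
    then show ?thesis
      using that finite_cells by simp
  qed
  ultimately show ?thesis
    by (simp add: Q.mem_WZ ball_cells1_Q)
qed

lemma mem_WX_Q: "v \<in> WX Q \<longleftrightarrow> v \<in> vspace (cells1 Q) \<and> (\<exists>c.
    (\<forall>q\<in>cells1 X. \<forall>a\<in>A. v (Inl (q, a)) =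
      (\<Sum>p\<in>cells0 X. c (Inl (p, a)) * HX X p q) + (\<Sum>b\<in>B. c (Inr (q, b)) * H b a)) \<and>
    (\<forall>r\<in>cells2 X. \<forall>b\<in>B. v (Inr (r, b)) = (\<Sum>q\<in>cells1 X. c (Inr (q, b)) * HZ X r q)))"
proof -
  have "(\<Sum>x\<in>cells0 Q. c x * HX Q x (Inl (q, a))) =
      (\<Sum>p\<in>cells0 X. c (Inl (p, a)) * HX X p q) + (\<Sum>b\<in>B. c (Inr (q, b)) * H b a)"
    if "q \<in> cells1 X" "a \<in> A" for c q a
  proof -
    have "(\<Sum>q'\<in>cells1 X. \<Sum>b\<in>B. c (Inr (q', b)) * HX Q (Inr (q', b)) (Inl (q, a))) =
      (\<Sum>q'\<in>cells1 X. if q = q' then \<Sum>b\<in>B. c (Inr (q', b)) * H b a else 0)"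
      using that by (intro sum.cong) (auto simp: HX_Q intro!: sum.neutral)
    moreover have "(\<Sum>p\<in>cells0 X. \<Sum>a'\<in>A. c (Inl (p, a')) * HX Q (Inl (p, a')) (Inl (q, a))) =
      (\<Sum>p\<in>cells0 X. c (Inl (p, a)) * HX X p q)"
      using that finite_A
      by (simp add: HX_Q if_distrib[where f = "\<lambda>c. _ * c"] cong: sum.cong_simp if_cong)
    ultimately show ?thesis
      using that finite_cells by (simp add: sum_cells0_Q)
  qed
  moreover have "(\<Sum>x\<in>cells0 Q. c x * HX Q x (Inr (r, b))) = (\<Sum>q\<in>cells1 X. c (Inr (q, b)) * HZ X r q)"
    if "r \<in> cells2 X" "b \<in> B" for c r b
    using that finite_B
    by (simp add: sum_cells0_Q HX_Q' if_distrib[where f = "\<lambda>c. _ * c"] cong: sum.cong_simp if_cong)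
  ultimately show ?thesis
    by (simp add: Q.mem_WX ball_cells1_Q)
qed

end

section \<open>Sparsity of the product matrices\<close>

lemma card_le_add_of_images:
  assumes "T \<subseteq> f ` S \<union> g ` S'" "finite S" "finite S'"
  shows "card T \<le> card S + card S'"
proof -
  have "card T \<le> card (f ` S \<union> g ` S')"
    using assms by (intro card_mono) auto
  also have "\<dots> \<le> card S + card S'"
    using card_Un_le card_image_le assms by (meson add_mono order_trans)
  finally show ?thesis .
qed

text \<open>The elementary tensor of \<open>x\<close> and \<open>c\<close>, extended by zero to the
  \<open>X2 * B\<close> block. It serves as a cycle when \<open>c\<close> is a codeword and as a
  cocycle when \<open>c\<close> is a unit vector.\<close>

definition tensor_vec :: "('q \<Rightarrow> bit) \<Rightarrow> ('a \<Rightarrow> bit) \<Rightarrow> ('q \<times> 'a) + ('r \<times> 'b) \<Rightarrow> bit" where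
  "tensor_vec x c y = (case y of Inl (q, a) \<Rightarrow> x q * c a | Inr _ \<Rightarrow> 0)"

lemma tensor_vec_simps [simp]:
  "tensor_vec x c (Inl (q, a)) = x q * c a" "tensor_vec x c (Inr y) = 0"
  by (simp_all add: tensor_vec_def)

lemma hamming_weight_tensor_vec:
  "hamming_weight (tensor_vec x c :: ('q \<times> 'a) + ('r \<times> 'b) \<Rightarrow> bit) = hamming_weight x * hamming_weight c"
proof -
  let ?t = "tensor_vec x c :: ('q \<times> 'a) + ('r \<times> 'b) \<Rightarrow> bit"
  have "?t y \<noteq> 0 \<longleftrightarrow> y \<in> Inl ` ({q. x q \<noteq> 0} \<times> {a. c a \<noteq> 0})" for y
    by (cases y) (auto simp: tensor_vec_def simp del: bit_not_zero_iff)
  then have "{y. ?t y \<noteq> 0} = Inl ` ({q. x q \<noteq> 0} \<times> {a. c a \<noteq> 0})"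
    by blast
  then show ?thesis
    by (simp add: hamming_weight_def card_image card_cartesian_product del: bit_not_zero_iff)
qed

context product_code
begin

text \<open>Row \<open>(p, a)\<close> is a copy of row \<open>p\<close> of \<open>HX X\<close>,
  while row \<open>(q, b)\<close> joins column \<open>q\<close> of \<open>HZ X\<close> to row
  \<open>b\<close> of \<open>H\<close>. This is why row and column bounds mix; the sum of all three
  constants covers both kinds of rows.\<close>

lemma row_weights_HX_Q:
  assumes "\<forall>p\<in>cells0 X. card {q \<in> cells1 X. HX X p q = 1} \<le> w1"
    and "\<forall>q\<in>cells1 X. card {r \<in> cells2 X. HZ X r q = 1} \<le> w2"
    and "\<forall>b\<in>B. card {a \<in> A. H b a = 1} \<le> w3"
  shows "\<forall>x\<in>cells0 Q. card {y \<in> cells1 Q. HX Q x y = 1} \<le> w1 + w2 + w3"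
proof
  fix x assume "x \<in> cells0 Q"
  then consider p a where "x = Inl (p, a)" "p \<in> cells0 X" "a \<in> A"
    | q b where "x = Inr (q, b)" "q \<in> cells1 X" "b \<in> B"
    by (auto simp: cells_Q)
  then show "card {y \<in> cells1 Q. HX Q x y = 1} \<le> w1 + w2 + w3"
  proof cases
    case (1 p a)
    then have "{y \<in> cells1 Q. HX Q x y = 1} \<subseteq> (\<lambda>q. Inl (q, a)) ` {q \<in> cells1 X. HX X p q = 1}"
      by (auto simp: cells_Q HX_Q HX_Q' split: if_splits)
    from surj_card_le[OF _ this] show ?thesis
      using 1 assms finite_cells by fastforce
  next
    case (2 q b)
    then have "{y \<in> cells1 Q. HX Q x y = 1} \<subseteq> (\<lambda>a. Inl (q, a)) ` {a \<in> A. H b a = 1} \<union>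
        (\<lambda>r. Inr (r, b)) ` {r \<in> cells2 X. HZ X r q = 1}"
      by (auto simp: cells_Q HX_Q HX_Q' split: if_splits)
    from card_le_add_of_images[OF this] show ?thesis
      using 2 assms finite_cells finite_A by fastforce
  qed
qed

lemma col_weights_HX_Q:
  assumes "\<forall>q\<in>cells1 X. card {p \<in> cells0 X. HX X p q = 1} \<le> w1"
    and "\<forall>r\<in>cells2 X. card {q \<in> cells1 X. HZ X r q = 1} \<le> w2"
    and "\<forall>a\<in>A. card {b \<in> B. H b a = 1} \<le> w3"
  shows "\<forall>y\<in>cells1 Q. card {x \<in> cells0 Q. HX Q x y = 1} \<le> w1 + w2 + w3"
proof
  fix y assume "y \<in> cells1 Q"
  then consider q a where "y = Inl (q, a)" "q \<in> cells1 X" "a \<in> A"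
    | r b where "y = Inr (r, b)" "r \<in> cells2 X" "b \<in> B"
    by (auto simp: cells_Q)
  then show "card {x \<in> cells0 Q. HX Q x y = 1} \<le> w1 + w2 + w3"
  proof cases
    case (1 q a)
    then have "{x \<in> cells0 Q. HX Q x y = 1} \<subseteq> (\<lambda>p. Inl (p, a)) ` {p \<in> cells0 X. HX X p q = 1} \<union>
        (\<lambda>b. Inr (q, b)) ` {b \<in> B. H b a = 1}"
      by (auto simp: cells_Q HX_Q split: if_splits)
    from card_le_add_of_images[OF this] show ?thesis
      using 1 assms finite_cells finite_B by fastforce
  next
    case (2 r b)
    then have "{x \<in> cells0 Q. HX Q x y = 1} \<subseteq> (\<lambda>q. Inr (q, b)) ` {q \<in> cells1 X. HZ X r q = 1}"
      by (auto simp: cells_Q HX_Q' split: if_splits)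
    from surj_card_le[OF _ this] show ?thesis
      using 2 assms finite_cells by fastforce
  qed
qed

lemma row_weights_HZ_Q:
  assumes "\<forall>r\<in>cells2 X. card {q \<in> cells1 X. HZ X r q = 1} \<le> w2"
    and "\<forall>a\<in>A. card {b \<in> B. H b a = 1} \<le> w3"
  shows "\<forall>z\<in>cells2 Q. card {y \<in> cells1 Q. HZ Q z y = 1} \<le> w2 + w3"
proof
  fix z assume "z \<in> cells2 Q"
  then obtain r a where z: "z = (r, a)" "r \<in> cells2 X" "a \<in> A"
    by (auto simp: cells_Q)
  then have "{y \<in> cells1 Q. HZ Q z y = 1} \<subseteq> (\<lambda>q. Inl (q, a)) ` {q \<in> cells1 X. HZ X r q = 1} \<union>
      (\<lambda>b. Inr (r, b)) ` {b \<in> B. H b a = 1}"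
    by (auto simp: cells_Q HZ_Q split: if_splits)
  from card_le_add_of_images[OF this] show "card {y \<in> cells1 Q. HZ Q z y = 1} \<le> w2 + w3"
    using z assms finite_cells finite_B by fastforce
qed

lemma col_weights_HZ_Q:
  assumes "\<forall>q\<in>cells1 X. card {r \<in> cells2 X. HZ X r q = 1} \<le> w2"
    and "\<forall>b\<in>B. card {a \<in> A. H b a = 1} \<le> w3"
  shows "\<forall>y\<in>cells1 Q. card {z \<in> cells2 Q. HZ Q z y = 1} \<le> w2 + w3"
proof
  fix y assume "y \<in> cells1 Q"
  then consider q a where "y = Inl (q, a)" "q \<in> cells1 X" "a \<in> A"
    | r b where "y = Inr (r, b)" "r \<in> cells2 X" "b \<in> B"
    by (auto simp: cells_Q)
  then show "card {z \<in> cells2 Q. HZ Q z y = 1} \<le> w2 + w3"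
  proof cases
    case (1 q a)
    then have "{z \<in> cells2 Q. HZ Q z y = 1} \<subseteq> (\<lambda>r. (r, a)) ` {r \<in> cells2 X. HZ X r q = 1}"
      by (auto simp: cells_Q HZ_Q split: if_splits)
    from surj_card_le[OF _ this] show ?thesis
      using 1 assms finite_cells by fastforce
  next
    case (2 r b)
    then have "{z \<in> cells2 Q. HZ Q z y = 1} \<subseteq> (\<lambda>a. (r, a)) ` {a \<in> A. H b a = 1}"
      by (auto simp: cells_Q HZ_Q split: if_splits)
    from surj_card_le[OF _ this] show ?thesis
      using 2 assms finite_A by fastforce
  qed
qed

section \<open>Cycles from tensors, cocycles from codeword combinations\<close>

abbreviation "C \<equiv> classical_code B A H"

lemma row_in_CX: "v \<in> CX Q \<Longrightarrow> a \<in> A \<Longrightarrow> (\<lambda>q. v (Inl (q, a))) \<in> CX X"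
  by (simp add: mem_CX_Q mem_CX vspace_Q)

lemma tensor_vec_in_vspace:
  "x \<in> vspace (cells1 X) \<Longrightarrow> c \<in> vspace A \<Longrightarrow> tensor_vec x c \<in> vspace (cells1 Q)"
  by (auto simp: vspace_def cells_Q tensor_vec_def split: sum.splits)

lemma tensor_vec_in_CX_Q:
  assumes "x \<in> CX X" "c \<in> C"
  shows "tensor_vec x c \<in> CX Q"
proof -
  have "(\<Sum>q\<in>cells1 X. HX X p q * (x q * c a)) = (\<Sum>q\<in>cells1 X. HX X p q * x q) * c a" for p a
    by (simp add: sum_distrib_right mult.assoc)
  moreover have "(\<Sum>a\<in>A. H b a * (x q * c a)) = x q * (\<Sum>a\<in>A. H b a * c a)" for b q
    by (simp add: sum_distrib_left mult.left_commute)
  ultimately show ?thesis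
    using assms by (simp add: mem_CX_Q mem_CX tensor_vec_in_vspace classical_code_def)
qed

text \<open>For fixed \<open>r\<close>, the cocycle condition writes the coboundaries of the rows,
  as a vector over \<open>A\<close>, as a combination of rows of \<open>H\<close>; pairing with a
  codeword kills it.\<close>

lemma combination_in_CZ:
  assumes "v \<in> CZ Q" "c \<in> C"
  shows "(\<lambda>q. \<Sum>a\<in>A. c a * v (Inl (q, a))) \<in> CZ X"
proof -
  have "(\<Sum>q\<in>cells1 X. HZ X r q * (\<Sum>a\<in>A. v (Inl (q, a)) * c a)) = 0" if r: "r \<in> cells2 X" for r
  proof -
    have "(\<Sum>q\<in>cells1 X. HZ X r q * (\<Sum>a\<in>A. v (Inl (q, a)) * c a)) =
      (\<Sum>a\<in>A. (\<Sum>q\<in>cells1 X. HZ X r q * v (Inl (q, a))) * c a)"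
      by (rule sum_mult_swap)
    also have "\<dots> = (\<Sum>a\<in>A. c a * (\<Sum>b\<in>B. H b a * v (Inr (r, b))))"
      using assms(1) r by (intro sum.cong) (auto simp: mem_CZ_Q mult.commute[of _ "c _"])
    also have "\<dots> = (\<Sum>b\<in>B. (\<Sum>a\<in>A. c a * H b a) * v (Inr (r, b)))"
      by (rule sum_mult_swap)
    also have "\<dots> = 0"
      using assms(2) by (simp add: classical_code_def mult.commute[of "c _"])
    finally show ?thesis .
  qed
  moreover have "(\<lambda>q. \<Sum>a\<in>A. c a * v (Inl (q, a))) \<in> vspace (cells1 X)"
    using assms(1) by (auto simp: mem_CZ_Q vspace_def cells_Q)
  ultimately show ?thesis
    by (simp add: mem_CZ mult.commute)
qed

text \<open>A nonzero value at \<open>q\<close> requires some \<open>v (Inl (q, a))\<close> to be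
  nonzero, so projecting the support of \<open>v\<close> to \<open>X1\<close> covers the support of
  the combination.\<close>

lemma combination_weight_le:
  assumes "v \<in> vspace (cells1 Q)"
  shows "hamming_weight (\<lambda>q. \<Sum>a\<in>A. c a * v (Inl (q, a))) \<le> hamming_weight v"
  unfolding hamming_weight_def
proof (rule surj_card_le)
  show "finite {y. v y \<noteq> 0}"
    using finite_support finite_cells_Q assms by blast
  \<comment> \<open>The unspecified values of \<open>projl\<close> on \<open>Inr\<close> are
    harmless, as only an inclusion is claimed.\<close>
  show "{q. (\<Sum>a\<in>A. c a * v (Inl (q, a))) \<noteq> 0} \<subseteq> (fst \<circ> projl) ` {y. v y \<noteq> 0}"
  proof
    fix q assume "q \<in> {q. (\<Sum>a\<in>A. c a * v (Inl (q, a))) \<noteq> 0}"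
    then obtain a where "v (Inl (q, a)) \<noteq> 0"
      by (metis (mono_tags, lifting) mem_Collect_eq mult_zero_right sum.neutral)
    then show "q \<in> (fst \<circ> projl) ` {y. v y \<noteq> 0}"
      by (intro image_eqI[of _ _ "Inl (q, a)"]) auto
  qed
qed

end

section \<open>Boundaries and coboundaries recognized through the rows\<close>

locale full_rank_product_code = product_code X A B H
  for X :: "('p, 'q, 'r) cell_complex" and A :: "'a set" and B :: "'b set" and H +
  fixes S :: "'a \<Rightarrow> 'b \<Rightarrow> bit"
  assumes right_inverse: "\<And>b b'. b \<in> B \<Longrightarrow> (\<Sum>a\<in>A. H b a * S a b') = (if b' = b then 1 else 0)"
begin

text \<open>Fillings \<open>z a\<close> of the single rows settle the \<open>X1 * A\<close> block
  but may miss the \<open>X2 * B\<close> block by some \<open>w\<close>. Each \<open>w _ b\<close>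
  has zero boundary in \<open>X\<close>, so adding \<open>S w\<close> to the filling leaves the
  first block intact, and \<open>H S = 1\<close> makes it contribute exactly \<open>w\<close> to the
  second.\<close>

lemma WZ_Q_iff:
  assumes v: "v \<in> CX Q"
  shows "v \<in> WZ Q \<longleftrightarrow> (\<forall>a\<in>A. (\<lambda>q. v (Inl (q, a))) \<in> WZ X)"
proof
  assume "v \<in> WZ Q"
  then obtain c where "\<forall>q\<in>cells1 X. \<forall>a\<in>A. v (Inl (q, a)) = (\<Sum>r\<in>cells2 X. c (r, a) * HZ X r q)"
    by (auto simp: mem_WZ_Q)
  then show "\<forall>a\<in>A. (\<lambda>q. v (Inl (q, a))) \<in> WZ X"
    using v by (auto simp: mem_WZ mem_CX_Q vspace_Q intro!: exI[of _ "\<lambda>r. c (r, _)"])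
next
  assume "\<forall>a\<in>A. (\<lambda>q. v (Inl (q, a))) \<in> WZ X"
  then have "\<forall>a\<in>A. \<exists>z. \<forall>q\<in>cells1 X. v (Inl (q, a)) = (\<Sum>r\<in>cells2 X. z r * HZ X r q)"
    by (auto simp: mem_WZ)
  then obtain z where z: "\<And>a q. a \<in> A \<Longrightarrow> q \<in> cells1 X \<Longrightarrow> v (Inl (q, a)) = (\<Sum>r\<in>cells2 X. z a r * HZ X r q)"
    by metis
  \<comment> \<open>Subtracting the boundary of \<open>z\<close> leaves the cycle \<open>w\<close> over \<open>B\<close>, whose lift along \<open>S\<close> bounds it.\<close>
  define w where "w r b = v (Inr (r, b)) + (\<Sum>a\<in>A. H b a * z a r)" for r b
  define c where "c = (\<lambda>(r, a). z a r + (\<Sum>b\<in>B. S a b * w r b))"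
  \<comment> \<open>By the cycle condition on \<open>v\<close>, the two summands of \<open>w\<close>
    have the same boundary.\<close>
  have w: "(\<Sum>r\<in>cells2 X. w r b * HZ X r q) = 0" if "q \<in> cells1 X" "b \<in> B" for q b
  proof -
    have "(\<Sum>r\<in>cells2 X. (\<Sum>a\<in>A. H b a * z a r) * HZ X r q) = (\<Sum>a\<in>A. H b a * v (Inl (q, a)))"
      using that by (simp add: z flip: sum_mult_swap)
    also have "\<dots> = (\<Sum>r\<in>cells2 X. v (Inr (r, b)) * HZ X r q)"
      using v that by (simp add: mem_CX_Q mult.commute)
    finally show ?thesis
      by (simp add: w_def distrib_right sum.distrib)
  qed
  have "v (Inl (q, a)) = (\<Sum>r\<in>cells2 X. c (r, a) * HZ X r q)" if "q \<in> cells1 X" "a \<in> A" for q a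
    using that by (simp add: c_def z distrib_right sum.distrib w flip: sum_mult_swap)
  moreover have "v (Inr (r, b)) = (\<Sum>a\<in>A. c (r, a) * H b a)" if "r \<in> cells2 X" "b \<in> B" for r b
  proof -
    have "(\<Sum>a\<in>A. H b a * c (r, a)) =
      (\<Sum>a\<in>A. H b a * z a r) + (\<Sum>b'\<in>B. (\<Sum>a\<in>A. H b a * S a b') * w r b')"
      by (simp add: c_def distrib_left sum.distrib sum_mult_swap)
    also have "\<dots> = (\<Sum>a\<in>A. H b a * z a r) + w r b"
      using that finite_B by (simp add: right_inverse if_distrib[where f = "\<lambda>c. c * _"] cong: if_cong)
    also have "\<dots> = v (Inr (r, b))"
      by (simp add: w_def add.left_commute)
    finally show ?thesis
      by (simp add: mult.commute)
  qed
  ultimately show "v \<in> WZ Q"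
    using v by (auto simp: mem_WZ_Q mem_CX_Q)
qed

text \<open>Codewords annihilate whatever a coboundary receives through \<open>H\<close>.
  Conversely, the identity on vectors over \<open>A\<close> is \<open>P + S H\<close>: the
  \<open>P\<close> part of \<open>v\<close> consists of codeword combinations, coboundaries of
  \<open>X\<close> by assumption, and the rest comes through \<open>H\<close> from the cells
  \<open>(q, b)\<close>. The \<open>X2 * B\<close> block is then forced by the cocycle condition and
  \<open>H S = 1\<close>.\<close>

lemma WX_Q_iff:
  assumes v: "v \<in> CZ Q"
  shows "v \<in> WX Q \<longleftrightarrow> (\<forall>c\<in>C. (\<lambda>q. \<Sum>a\<in>A. c a * v (Inl (q, a))) \<in> WX X)"
proof
  assume "v \<in> WX Q"
  then obtain d where d: "\<And>q a. q \<in> cells1 X \<Longrightarrow> a \<in> A \<Longrightarrow> v (Inl (q, a)) =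
      (\<Sum>p\<in>cells0 X. d (Inl (p, a)) * HX X p q) + (\<Sum>b\<in>B. H b a * d (Inr (q, b)))"
    by (auto simp: mem_WX_Q mult.commute)
  show "\<forall>c\<in>C. (\<lambda>q. \<Sum>a\<in>A. c a * v (Inl (q, a))) \<in> WX X"
  proof
    fix c assume c: "c \<in> C"
    have "(\<Sum>a\<in>A. c a * v (Inl (q, a))) = (\<Sum>p\<in>cells0 X. (\<Sum>a\<in>A. c a * d (Inl (p, a))) * HX X p q)"
      if "q \<in> cells1 X" for q
    proof -
      have "(\<Sum>a\<in>A. c a * H b a) = 0" if "b \<in> B" for b
        using c that by (simp add: classical_code_def mult.commute)
      then show ?thesis
        using that by (simp add: d distrib_left sum.distrib sum_mult_swap)
    qed
    moreover have "(\<lambda>q. \<Sum>a\<in>A. c a * v (Inl (q, a))) \<in> vspace (cells1 X)"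
      using combination_in_CZ[OF v c] by (simp add: mem_CZ)
    ultimately show "(\<lambda>q. \<Sum>a\<in>A. c a * v (Inl (q, a))) \<in> WX X"
      by (auto simp: mem_WX intro!: exI[of _ "\<lambda>p. \<Sum>a\<in>A. c a * d (Inl (p, a))"])
  qed
next
  assume comb: "\<forall>c\<in>C. (\<lambda>q. \<Sum>a\<in>A. c a * v (Inl (q, a))) \<in> WX X"
  \<comment> \<open>The columns of \<open>1 - S H\<close>, the projection onto \<open>C\<close>\<close>
  define P where "P a' = (\<lambda>a. if a \<in> A then (if a = a' then 1 else 0) + (\<Sum>b\<in>B. S a b * H b a') else 0)" for a'
  \<comment> \<open>This is \<open>f P = f + (f S) H\<close> for a row vector
    \<open>f\<close>.\<close>
  have P_sum: "(\<Sum>a\<in>A. f a * P a' a) = f a' + (\<Sum>b\<in>B. (\<Sum>a\<in>A. f a * S a b) * H b a')" if "a' \<in> A" for f a'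
    using that finite_A by (simp add: P_def distrib_left sum.distrib sum_mult_swap
        if_distrib[where f = "\<lambda>c. _ * c"] cong: sum.cong_simp if_cong)
  \<comment> \<open>\<open>H P = H + (H S) H = 0\<close>.\<close>
  have P_C: "P a' \<in> C" if "a' \<in> A" for a'
  proof -
    have "(\<Sum>a\<in>A. H b a * P a' a) = 0" if "b \<in> B" for b
      using that \<open>a' \<in> A\<close> finite_B
      by (simp add: P_sum right_inverse if_distrib[where f = "\<lambda>c. c * _"] cong: if_cong)
    moreover have "P a' \<in> vspace A"
      by (simp add: P_def vspace_def)
    ultimately show ?thesis
      by (simp add: classical_code_def)
  qed
  have "\<forall>a\<in>A. \<exists>z. \<forall>q\<in>cells1 X. (\<Sum>a'\<in>A. v (Inl (q, a')) * P a a') = (\<Sum>p\<in>cells0 X. z p * HX X p q)"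
    using comb P_C by (auto simp: mem_WX mult.commute)
  then obtain z where z: "\<And>a q. a \<in> A \<Longrightarrow> q \<in> cells1 X \<Longrightarrow>
      (\<Sum>a'\<in>A. v (Inl (q, a')) * P a a') = (\<Sum>p\<in>cells0 X. z a p * HX X p q)"
    by metis
  \<comment> \<open>On \<open>(p, a)\<close> the witness is the one for the combination with
    \<open>P a\<close>; on \<open>(q, b)\<close> it is the entry of \<open>v S\<close>.\<close>
  define d where "d = case_sum (\<lambda>(p, a). z a p) (\<lambda>(q, b). \<Sum>a\<in>A. v (Inl (q, a)) * S a b)"
  have "v (Inl (q, a)) = (\<Sum>p\<in>cells0 X. d (Inl (p, a)) * HX X p q) + (\<Sum>b\<in>B. d (Inr (q, b)) * H b a)"
    if "q \<in> cells1 X" "a \<in> A" for q a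
  proof -
    have "v (Inl (q, a)) + (\<Sum>b\<in>B. d (Inr (q, b)) * H b a) = (\<Sum>p\<in>cells0 X. d (Inl (p, a)) * HX X p q)"
      using z[OF that(2,1)] P_sum[OF that(2), of "\<lambda>a'. v (Inl (q, a'))"] by (simp add: d_def)
    then show ?thesis
      by (rule bit_add_eq_iff[THEN iffD1])
  qed
  moreover have "v (Inr (r, b)) = (\<Sum>q\<in>cells1 X. d (Inr (q, b)) * HZ X r q)"
    if "r \<in> cells2 X" "b \<in> B" for r b
  proof -
    have "(\<Sum>q\<in>cells1 X. HZ X r q * d (Inr (q, b))) = (\<Sum>a\<in>A. (\<Sum>q\<in>cells1 X. HZ X r q * v (Inl (q, a))) * S a b)"
      by (simp add: d_def sum_mult_swap)
    also have "\<dots> = (\<Sum>a\<in>A. (\<Sum>b'\<in>B. v (Inr (r, b')) * H b' a) * S a b)"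
      using v that by (intro sum.cong) (auto simp: mem_CZ_Q mult.commute[of "v _"])
    also have "\<dots> = (\<Sum>b'\<in>B. v (Inr (r, b')) * (\<Sum>a\<in>A. H b' a * S a b))"
      by (rule sum_mult_swap[symmetric])
    also have "\<dots> = v (Inr (r, b))"
      using that finite_B by (simp add: right_inverse if_distrib[where f = "\<lambda>c. _ * c"] cong: sum.cong_simp if_cong)
    finally show ?thesis
      by (simp add: mult.commute)
  qed
  ultimately show "v \<in> WX Q"
    using v by (auto simp: mem_WX_Q mem_CZ_Q)
qed

end

section \<open>Dimension and distances of the product code\<close>

context full_rank_product_code
begin

text \<open>Check \<open>b\<close> applied to the rows yields a member of \<open>WZ X\<close>, where
  \<open>f\<close> vanishes; additivity carries the check through \<open>f\<close> to each
  coordinate \<open>e\<close>.\<close>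

lemma coeff_rows_in_code:
  assumes add: "\<And>u v. u \<in> CX X \<Longrightarrow> v \<in> CX X \<Longrightarrow> f (u + v) = f u + f v"
    and ker: "\<And>v. v \<in> CX X \<Longrightarrow> f v = 0 \<longleftrightarrow> v \<in> WZ X"
    and v: "v \<in> CX Q"
  shows "(\<lambda>a. if a \<in> A then f (\<lambda>q. v (Inl (q, a))) e else 0) \<in> C"
proof -
  have f0: "f 0 = 0"
    using ker f2.subspace_0[OF subspaces(1)] f2.subspace_0[OF subspaces(4)] by blast
  have f_sum: "(\<Sum>t\<in>T. u t) \<in> CX X \<and> f (\<Sum>t\<in>T. u t) = (\<Sum>t\<in>T. f (u t))"
    if "\<And>t. t \<in> T \<Longrightarrow> u t \<in> CX X" for T :: "'a set" and u
    using that
  proof (induction T rule: infinite_finite_induct)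
    case (insert t T)
    then have t: "u t \<in> CX X" and T: "sum u T \<in> CX X" "f (sum u T) = (\<Sum>t\<in>T. f (u t))"
      by blast+
    then show ?case
      using f2.subspace_add[OF subspaces(1) t T(1)] by (simp only: sum.insert[OF insert.hyps] add simp_thms)
  qed (simp_all only: sum.infinite sum.empty f0 f2.subspace_0[OF subspaces(1)] simp_thms)
  have "(\<Sum>a\<in>A. H b a * f (\<lambda>q. v (Inl (q, a))) e) = 0" if "b \<in> B" for b
  proof -
    \<comment> \<open>Only additivity of \<open>f\<close> is assumed, so the weighted sum is
      replaced by a plain sum over the support of row \<open>b\<close> of \<open>H\<close>.\<close>
    let ?T = "{a \<in> A. H b a = 1}"
    have sum: "(\<Sum>a\<in>?T. (\<lambda>q. v (Inl (q, a)))) = (\<lambda>q. \<Sum>a\<in>A. H b a * v (Inl (q, a)))"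
      using finite_A by (simp add: fun_eq_iff sum_bit_filter)
    have rows: "(\<Sum>a\<in>?T. (\<lambda>q. v (Inl (q, a)))) \<in> CX X \<and>
        f (\<Sum>a\<in>?T. (\<lambda>q. v (Inl (q, a)))) = (\<Sum>a\<in>?T. f (\<lambda>q. v (Inl (q, a))))"
      using row_in_CX[OF v] by (intro f_sum) auto
    have "(\<lambda>q. \<Sum>a\<in>A. H b a * v (Inl (q, a))) \<in> WZ X"
      using v that unfolding mem_WZ
      by (auto simp: mem_CX_Q vspace_def cells_Q mult.commute intro!: exI[of _ "\<lambda>r. v (Inr (r, b))"])
    then have "f (\<Sum>a\<in>?T. (\<lambda>q. v (Inl (q, a)))) = 0"
      using rows ker unfolding sum by blast
    then have "(\<Sum>a\<in>?T. f (\<lambda>q. v (Inl (q, a)))) e = 0"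
      using rows by simp
    then show ?thesis
      using finite_A by (simp add: sum_bit_filter)
  qed
  then show ?thesis
    by (simp add: classical_code_def vspace_def)
qed

text \<open>\<open>CX Q\<close> is counted twice, once by families of codewords indexed by a
  quotient basis of \<open>X\<close> and once by its own quotient dimension. The common factor
  \<open>card (WZ Q)\<close> is positive, so the exponents of 2 agree.\<close>

lemma css_dim_Q: "css_dim Q = css_dim X * f2.dim C"
proof -
  obtain E where E: "quotient_basis (CX X) (WZ X) E"
    using ex_quotient_basis[OF subspaces(4) WZ_subset_CX finite_CX] by blast
  then have E_dim: "css_dim X = card E" and finE: "finite E" and E_CX: "E \<subseteq> CX X"
    using quotient_dim_eqI[OF E subspaces(1,4) WZ_subset_CX finite_CX]
    by (simp_all add: css_dim_def quotient_basis_def)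
  obtain f where f: "\<And>v. v \<in> CX X \<Longrightarrow> f v \<in> vspace E"
    "\<And>u v. u \<in> CX X \<Longrightarrow> v \<in> CX X \<Longrightarrow> f (u + v) = f u + f v"
    "\<And>v. v \<in> CX X \<Longrightarrow> f v = 0 \<longleftrightarrow> v \<in> WZ X"
    "\<And>c. c \<in> vspace E \<Longrightarrow> (\<Sum>e\<in>E. vscale (c e) e) \<in> CX X \<and> f (\<Sum>e\<in>E. vscale (c e) e) = c"
    by (rule quotient_basis_coeff[OF E subspaces(1,4) WZ_subset_CX]) (assumption | blast)+
  \<comment> \<open>For fixed \<open>e\<close>, the coordinates of the row classes along
    \<open>A\<close>; restriction to \<open>E\<close> makes the family an element of
    \<open>PiE\<close>.\<close>
  define \<Phi> where "\<Phi> v = (\<lambda>e\<in>E. \<lambda>a. if a \<in> A then f (\<lambda>q. v (Inl (q, a))) e else 0)" for v :: "('q \<times> 'a) + ('r \<times> 'b) \<Rightarrow> bit"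
  \<comment> \<open>The section: the sum over \<open>e\<close> of the tensors of \<open>e\<close>
    with the codeword \<open>m e\<close>.\<close>
  define g where "g m = (\<lambda>y. case y of Inl (q, a) \<Rightarrow> \<Sum>e\<in>E. m e a * e q | Inr (y' :: 'r \<times> 'b) \<Rightarrow> 0)"
    for m :: "('q \<Rightarrow> bit) \<Rightarrow> 'a \<Rightarrow> bit"
  have "card (CX Q) = card (WZ Q) * card (PiE E (\<lambda>_. C))"
  proof (rule card_eq_kernel_times_image[OF Q.subspaces(4) Q.WZ_subset_CX Q.subspaces(1)])
    fix v assume "v \<in> CX Q"
    then show "\<Phi> v \<in> PiE E (\<lambda>_. C)"
      using coeff_rows_in_code[OF f(2,3)] by (auto simp: \<Phi>_def)
  next
    fix m assume m: "m \<in> PiE E (\<lambda>_. C)"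
    define c where "c a = (\<lambda>e. if e \<in> E then m e a else 0)" for a
    have c: "(\<Sum>e\<in>E. vscale (c a e) e) \<in> CX X \<and> f (\<Sum>e\<in>E. vscale (c a e) e) = c a" for a
      by (rule f(4)) (simp add: c_def vspace_def)
    have row: "(\<lambda>q. g m (Inl (q, a))) = (\<Sum>e\<in>E. vscale (c a e) e)" for a
      by (simp add: g_def c_def fun_eq_iff)
    have m_code: "m e a = 0" if "e \<in> E" "a \<notin> A" for e a
      using m that by (auto simp: classical_code_def vspace_def)
    have "(\<Sum>e\<in>E. m e a * e q) = 0" if "q \<notin> cells1 X \<or> a \<notin> A" for q a
      using that E_CX m_code by (intro sum.neutral) (auto simp: mem_CX vspace_def)
    then have "g m \<in> vspace (cells1 Q)"
      by (auto simp: vspace_def cells_Q g_def split: sum.splits)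
    moreover have "(\<Sum>q\<in>cells1 X. HX X p q * g m (Inl (q, a))) = 0" if "p \<in> cells0 X" for p a
      using c[of a] that unfolding mem_CX row[symmetric] by blast
    moreover have "(\<Sum>a\<in>A. H b a * g m (Inl (q, a))) = 0" if "b \<in> B" for b q
    proof -
      have "(\<Sum>a\<in>A. H b a * m e a) = 0" if "e \<in> E" for e
        using m that \<open>b \<in> B\<close> by (auto simp: classical_code_def)
      then show ?thesis
        by (simp add: g_def sum_mult_swap)
    qed
    moreover have "\<Phi> (g m) = m"
    proof
      fix e
      show "\<Phi> (g m) e = m e"
      proof (cases "e \<in> E")
        case True
        then show ?thesis
          using m_code c by (auto simp: \<Phi>_def row fun_eq_iff c_def)
      next
        case False
        then show ?thesis
          using m by (auto simp: \<Phi>_def)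
      qed
    qed
    ultimately show "g m \<in> CX Q \<and> \<Phi> (g m) = m"
      by (simp add: mem_CX_Q) (simp add: g_def)
  next
    fix u v assume uv: "u \<in> CX Q" "v \<in> CX Q"
    let ?row = "\<lambda>w a q. w (Inl (q, a)) :: bit"
    have "u - v \<in> WZ Q \<longleftrightarrow> (\<forall>a\<in>A. ?row u a + ?row v a \<in> WZ X)"
      using WZ_Q_iff[OF f2.subspace_diff[OF Q.subspaces(1) uv]]
      by (simp add: fun_diff_eq_add plus_fun_def)
    also have "\<dots> \<longleftrightarrow> (\<forall>a\<in>A. f (?row u a) = f (?row v a))"
    proof (intro ball_cong refl)
      fix a assume "a \<in> A"
      then have "?row u a \<in> CX X" "?row v a \<in> CX X"
        using uv row_in_CX by auto
      then show "?row u a + ?row v a \<in> WZ X \<longleftrightarrow> f (?row u a) = f (?row v a)"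
        using f(3)[OF f2.subspace_add[OF subspaces(1)]] f(2) by (metis fun_add_eq_0_iff)
    qed
    also have "\<dots> \<longleftrightarrow> \<Phi> u = \<Phi> v"
    proof
      assume eq: "\<Phi> u = \<Phi> v"
      show "\<forall>a\<in>A. f (?row u a) = f (?row v a)"
      proof (intro ballI ext)
        fix a e assume a: "a \<in> A"
        show "f (?row u a) e = f (?row v a) e"
        proof (cases "e \<in> E")
          case True
          then show ?thesis
            using fun_cong[OF fun_cong[OF eq, of e], of a] a by (simp add: \<Phi>_def)
        next
          case False
          then show ?thesis
            using f(1)[OF row_in_CX[OF uv(1) a]] f(1)[OF row_in_CX[OF uv(2) a]] by (simp add: vspace_def)
        qed
      qed
    qed (auto simp: \<Phi>_def fun_eq_iff)
    finally show "\<Phi> u = \<Phi> v \<longleftrightarrow> u - v \<in> WZ Q"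
      by blast
  qed
  moreover have "card C = 2 ^ f2.dim C"
    by (rule card_subspace[OF subspace_classical_code finite_classical_code[OF finite_A]])
  then have "card (PiE E (\<lambda>_. C)) = 2 ^ (css_dim X * f2.dim C)"
    using finE by (simp add: card_PiE E_dim mult.commute flip: power_mult)
  ultimately have "card (CX Q) = card (WZ Q) * 2 ^ (css_dim X * f2.dim C)"
    by simp
  moreover have "card (CX Q) = card (WZ Q) * 2 ^ css_dim Q"
    unfolding css_dim_def by (rule card_quotient_dim[OF Q.subspaces(1,4) Q.WZ_subset_CX Q.finite_CX])
  moreover have "card (WZ Q) > 0"
    using f2.subspace_0[OF Q.subspaces(4)] Q.WZ_subset_CX Q.finite_CX
    by (metis card_gt_0_iff empty_iff finite_subset)
  ultimately show ?thesis
    by simp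
qed

text \<open>Both \<open>d\<close> and \<open>d'\<close> are arbitrary lower bounds, which keeps
  minima out of the counting argument.\<close>

lemma weight_ge_of_not_boundary:
  assumes v: "v \<in> CX Q" "v \<notin> WZ Q"
    and dx: "\<And>x. x \<in> CX X \<Longrightarrow> x \<notin> WZ X \<Longrightarrow> d \<le> hamming_weight x"
    and dc: "\<And>c. c \<in> C \<Longrightarrow> c \<noteq> 0 \<Longrightarrow> d' \<le> hamming_weight c"
  shows "d * d' \<le> hamming_weight v"
proof -
  let ?row = "\<lambda>a q. v (Inl (q, a))"
  obtain E where E: "quotient_basis (CX X) (WZ X) E"
    using ex_quotient_basis[OF subspaces(4) WZ_subset_CX finite_CX] by blast
  obtain f where f: "\<And>v. v \<in> CX X \<Longrightarrow> f v \<in> vspace E"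
    "\<And>u v. u \<in> CX X \<Longrightarrow> v \<in> CX X \<Longrightarrow> f (u + v) = f u + f v"
    "\<And>v. v \<in> CX X \<Longrightarrow> f v = 0 \<longleftrightarrow> v \<in> WZ X"
    "\<And>c. c \<in> vspace E \<Longrightarrow> (\<Sum>e\<in>E. vscale (c e) e) \<in> CX X \<and> f (\<Sum>e\<in>E. vscale (c e) e) = c"
    by (rule quotient_basis_coeff[OF E subspaces(1,4) WZ_subset_CX]) (assumption | blast)+
  obtain a0 where a0: "a0 \<in> A" "?row a0 \<notin> WZ X"
    using v WZ_Q_iff by blast
  then have "f (?row a0) \<noteq> 0"
    using f(3) row_in_CX[OF v(1)] by blast
  \<comment> \<open>A single coordinate suffices: its values along \<open>A\<close> form a codeword,
    nonzero at \<open>a0\<close>, and each \<open>a\<close> in its support marks a row outside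
    \<open>WZ X\<close>.\<close>
  then obtain e where e: "f (?row a0) e \<noteq> 0"
    by (auto simp: fun_eq_iff)
  define c where "c a = (if a \<in> A then f (?row a) e else 0)" for a
  have "c \<in> C"
    unfolding c_def by (rule coeff_rows_in_code[OF f(2,3) v(1)])
  moreover have "c \<noteq> 0"
    using a0 e by (auto simp: c_def fun_eq_iff)
  ultimately have c: "d' \<le> hamming_weight c"
    by (rule dc)
  have supp: "{a. c a \<noteq> 0} \<subseteq> A"
    by (auto simp: c_def)
  have fin: "finite {y. v y \<noteq> 0}"
    using finite_support Q.finite_cells v(1) by (auto simp: Q.mem_CX)
  have fin_row: "finite {q. v (Inl (q, a)) \<noteq> 0}" for a
    using finite_vimageI[OF fin, of "\<lambda>q. Inl (q, a)"] by (simp add: inj_def vimage_def)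
  have "d \<le> hamming_weight (?row a)" if "c a \<noteq> 0" for a
  proof -
    have "a \<in> A" "f (?row a) \<noteq> 0"
      using that by (auto simp: c_def split: if_splits)
    then show ?thesis
      using f(3) dx row_in_CX[OF v(1)] by blast
  qed
  then have "d * hamming_weight c \<le> (\<Sum>a\<in>{a. c a \<noteq> 0}. hamming_weight (?row a))"
    unfolding hamming_weight_def[of c] using sum_bounded_below[of "{a. c a \<noteq> 0}" d] by (simp add: mult.commute)
  \<comment> \<open>Rows with different \<open>a\<close> occupy disjoint parts of the support of
    \<open>v\<close>, so their weights add up.\<close>
  also have "\<dots> = card (SIGMA a:{a. c a \<noteq> 0}. {q. v (Inl (q, a)) \<noteq> 0})"
    unfolding hamming_weight_def using fin_row finite_subset[OF supp finite_A] by (subst card_SigmaI) auto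
  also have "\<dots> = card ((\<lambda>(a, q). Inl (q, a) :: ('q \<times> 'a) + ('r \<times> 'b)) ` (SIGMA a:{a. c a \<noteq> 0}. {q. v (Inl (q, a)) \<noteq> 0}))"
    by (rule card_image[symmetric]) (auto simp: inj_on_def)
  also have "\<dots> \<le> hamming_weight v"
    unfolding hamming_weight_def by (intro card_mono fin) auto
  finally show ?thesis
    using mult_le_mono2[OF c, of d] by linarith
qed

lemma finite_weight_sets:
  "finite (hamming_weight ` (CX X - WZ X))" "finite (hamming_weight ` (CZ X - WX X))"
  "finite (hamming_weight ` (CX Q - WZ Q))" "finite (hamming_weight ` (CZ Q - WX Q))"
  "finite (hamming_weight ` (C - {0}))"
  using finite_cells Q.finite_cells finite_A
  by (auto intro!: finite_weights simp: mem_CX mem_CZ Q.mem_CX Q.mem_CZ classical_code_def)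

lemma ex_nonzero_codeword:
  assumes "f2.dim C \<noteq> 0"
  shows "C - {0} \<noteq> {}"
proof
  assume "C - {0} = {}"
  then have "card C \<le> card {0 :: 'a \<Rightarrow> bit}"
    by (intro card_mono) auto
  moreover have "(2::nat) ^ 1 \<le> 2 ^ f2.dim C"
    using assms by (intro power_increasing) auto
  ultimately show False
    using card_subspace[OF subspace_classical_code finite_classical_code[OF finite_A], of B H] by simp
qed

lemma dX_Q:
  assumes "css_dim X \<noteq> 0" "f2.dim C \<noteq> 0"
  shows "dX Q = dX X * min_distance C"
proof -
  note min_C = min_distance_eq_min_weight[OF subspace_classical_code, of B A H]
  have "dX X \<in> hamming_weight ` (CX X - WZ X)"
    unfolding dX_def using CX_ne_WZ[OF assms(1)] finite_weight_sets by (intro Min_in) auto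
  then obtain x where x: "x \<in> CX X" "x \<notin> WZ X" "hamming_weight x = dX X"
    by auto
  have "min_distance C \<in> hamming_weight ` (C - {0})"
    unfolding min_C using ex_nonzero_codeword[OF assms(2)] finite_weight_sets by (intro Min_in) auto
  then obtain c where c: "c \<in> C" "c \<noteq> 0" "hamming_weight c = min_distance C"
    by fastforce
  show ?thesis
    unfolding dX_def[of Q]
  proof (rule Min_eqI[OF finite_weight_sets(3)])
    fix n assume "n \<in> hamming_weight ` (CX Q - WZ Q)"
    then obtain v where v: "v \<in> CX Q" "v \<notin> WZ Q" "n = hamming_weight v"
      by blast
    have "dX X \<le> hamming_weight y" if "y \<in> CX X" "y \<notin> WZ X" for y
      unfolding dX_def using that by (intro Min_le[OF finite_weight_sets(1)]) blast
    moreover have "min_distance C \<le> hamming_weight y" if "y \<in> C" "y \<noteq> 0" for y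
      unfolding min_C using that by (intro Min_le[OF finite_weight_sets(5)]) blast
    ultimately show "dX X * min_distance C \<le> n"
      unfolding v(3) by (rule weight_ge_of_not_boundary[OF v(1,2)])
  next
    \<comment> \<open>At a position with \<open>c a = 1\<close> the row of the tensor is
      \<open>x\<close> itself, so the tensor is not a boundary.\<close>
    obtain a where "c a \<noteq> 0"
      using c(2) by (auto simp: fun_eq_iff)
    then have a: "a \<in> A" "c a = 1"
      using c(1) by (auto simp: classical_code_def vspace_def)
    have T: "tensor_vec x c \<in> CX Q"
      using x c by (intro tensor_vec_in_CX_Q)
    then have "tensor_vec x c \<notin> WZ Q"
      using WZ_Q_iff[OF T] a x(2) by auto
    with T show "dX X * min_distance C \<in> hamming_weight ` (CX Q - WZ Q)"
      by (intro image_eqI[of _ _ "tensor_vec x c"]) (auto simp: hamming_weight_tensor_vec x c)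
  qed
qed

text \<open>One inequality combines rows by a codeword that detects \<open>v\<close>. The other
  places a cocycle \<open>x\<close> in a single row, at the same weight, which is why the minimum
  distance of \<open>C\<close> does not appear.\<close>

lemma dZ_Q:
  assumes "f2.dim C \<noteq> 0"
  shows "dZ Q = dZ X"
proof -
  have lower: "\<exists>x\<in>CZ X - WX X. hamming_weight x \<le> hamming_weight v" if v: "v \<in> CZ Q - WX Q" for v
  proof -
    obtain c where "c \<in> C" "(\<lambda>q. \<Sum>a\<in>A. c a * v (Inl (q, a))) \<notin> WX X"
      using v WX_Q_iff by blast
    moreover have "v \<in> vspace (cells1 Q)"
      using v by (simp add: mem_CZ_Q)
    ultimately show ?thesis
      using v combination_in_CZ combination_weight_le by blast
  qed
  have upper: "\<exists>v\<in>CZ Q - WX Q. hamming_weight v = hamming_weight x" if x: "x \<in> CZ X - WX X" for x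
  proof -
    obtain c where c: "c \<in> C" "c \<noteq> 0"
      using ex_nonzero_codeword[OF assms] by auto
    then obtain a where "c a \<noteq> 0"
      by (auto simp: fun_eq_iff)
    then have a: "a \<in> A" "c a = 1"
      using c(1) by (auto simp: classical_code_def vspace_def)
    \<comment> \<open>The position \<open>a\<close> lies in the support of the codeword
      \<open>c\<close>, so combining the rows with \<open>c\<close> returns \<open>x\<close> and
      detects that \<open>?v\<close> is not a coboundary.\<close>
    let ?v = "tensor_vec x (unit_vec a) :: ('q \<times> 'a) + ('r \<times> 'b) \<Rightarrow> bit"
    have "unit_vec a \<in> vspace A"
      using a by (auto simp: unit_vec_def vspace_def)
    moreover have "(\<Sum>q\<in>cells1 X. HZ X r q * (x q * k)) = (\<Sum>q\<in>cells1 X. HZ X r q * x q) * k" for r k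
      by (simp add: sum_distrib_right mult.assoc)
    ultimately have v: "?v \<in> CZ Q"
      using x by (simp add: mem_CZ_Q mem_CZ tensor_vec_in_vspace)
    have "(\<lambda>q. \<Sum>a'\<in>A. c a' * ?v (Inl (q, a'))) = x"
      using a finite_A by (simp add: fun_eq_iff unit_vec_def if_distrib[where f = "\<lambda>c. _ * c"] cong: if_cong)
    then have "?v \<notin> WX Q"
      using WX_Q_iff[OF v] c(1) x by auto
    moreover have "hamming_weight ?v = hamming_weight x"
      by (simp add: hamming_weight_tensor_vec) (simp add: hamming_weight_def unit_vec_def)
    ultimately show ?thesis
      using v by blast
  qed
  show ?thesis
  proof (cases "CZ X - WX X = {}")
    case True \<comment> \<open>then both distances are the unspecified value \<open>Min {}\<close>\<close>
    then have "CZ Q - WX Q = {}"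
      using lower by blast
    with True show ?thesis
      by (simp only: dZ_def image_empty)
  next
    case False
    then have "dZ X \<in> hamming_weight ` (CZ X - WX X)"
      unfolding dZ_def using finite_weight_sets by (intro Min_in) auto
    then obtain x where x: "x \<in> CZ X - WX X" "hamming_weight x = dZ X"
      by auto
    show ?thesis
      unfolding dZ_def[of Q]
    proof (rule Min_eqI[OF finite_weight_sets(4)])
      fix n assume "n \<in> hamming_weight ` (CZ Q - WX Q)"
      then obtain y where "y \<in> CZ X - WX X" "hamming_weight y \<le> n"
        using lower by blast
      then show "dZ X \<le> n"
        unfolding dZ_def using finite_weight_sets(2) by (meson Min_le image_eqI order_trans)
    next
      show "dZ X \<in> hamming_weight ` (CZ Q - WX Q)"
        using upper[OF x(1)] x(2) by (metis image_eqI)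
    qed
  qed
qed

end

subsection \<open>Families of product codes\<close>

lemma css_length_product_complex:
  assumes "chain_complex2 X" "finite A" "finite B"
  shows "css_length (product_complex X B A H) = card (cells1 X) * card A + card (cells2 X) * card B"
  using assms by (simp add: css_length_def product_complex_def chain_complex2_def card_Plus card_cartesian_product)

text \<open>The weight bounds of the product are sums of \<open>w1\<close>, \<open>w2\<close> and
  \<open>w3\<close>, none of which depends on \<open>i\<close>, so they hold for the whole
  family.\<close>

lemma ldpc_product_complex:
  assumes X: "ldpc_css_family X" and fin: "\<forall>i. finite (A i) \<and> finite (B i)"
    and H: "low_density B A H"
  shows "ldpc_css_family (\<lambda>i. product_complex (X i) (B i) (A i) (H i))"
proof -
  have code: "product_code (X i) (A i) (B i)" for i
    using X fin by unfold_locales (auto simp: ldpc_css_family_def)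
  from X obtain w1 where
    w1: "\<And>i. \<forall>p\<in>cells0 (X i). card {q \<in> cells1 (X i). HX (X i) p q = 1} \<le> w1"
      "\<And>i. \<forall>q\<in>cells1 (X i). card {p \<in> cells0 (X i). HX (X i) p q = 1} \<le> w1"
    unfolding ldpc_css_family_def low_density_def by blast
  from X obtain w2 where
    w2: "\<And>i. \<forall>r\<in>cells2 (X i). card {q \<in> cells1 (X i). HZ (X i) r q = 1} \<le> w2"
      "\<And>i. \<forall>q\<in>cells1 (X i). card {r \<in> cells2 (X i). HZ (X i) r q = 1} \<le> w2"
    unfolding ldpc_css_family_def low_density_def by blast
  from H obtain w3 where
    w3: "\<And>i. \<forall>b\<in>B i. card {a \<in> A i. H i b a = 1} \<le> w3"
      "\<And>i. \<forall>a\<in>A i. card {b \<in> B i. H i b a = 1} \<le> w3"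
    unfolding low_density_def by blast
  show ?thesis
    unfolding ldpc_css_family_def low_density_def
    using product_code.chain_complex2_Q[OF code]
      product_code.row_weights_HX_Q[OF code w1(1) w2(2) w3(1)]
      product_code.col_weights_HX_Q[OF code w1(2) w2(1) w3(2)]
      product_code.row_weights_HZ_Q[OF code w2(1) w3(2)]
      product_code.col_weights_HZ_Q[OF code w2(2) w3(1)]
    by blast
qed

theorem theorem2p3:
  fixes X :: "'i \<Rightarrow> ('p, 'q, 'r) cell_complex"
    and A :: "'i \<Rightarrow> 'a set"
    and B :: "'i \<Rightarrow> 'b set"
    and H :: "'i \<Rightarrow> 'b \<Rightarrow> 'a \<Rightarrow> bit"
  assumes "ldpc_css_family X"
    and "\<forall>i. css_dim (X i) \<noteq> 0"
    and "\<forall>i. finite (A i) \<and> finite (B i)"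
    and "low_density B A H"
    and "\<forall>i. f2.dim (classical_code (B i) (A i) (H i)) \<noteq> 0"
    and "\<forall>i. matrix_rank (B i) (A i) (H i) = card (B i)"
  shows "ldpc_css_family (\<lambda>i. product_complex (X i) (B i) (A i) (H i)) \<and>
    (\<forall>i. let Q = product_complex (X i) (B i) (A i) (H i);
             C = classical_code (B i) (A i) (H i)
         in css_length Q = card (cells1 (X i)) * card (A i) + card (cells2 (X i)) * card (B i) \<and>
            css_dim Q = css_dim (X i) * f2.dim C \<and>
            dX Q = dX (X i) * min_distance C \<and>
            dZ Q = dZ (X i))"
proof (intro conjI allI)
  show "ldpc_css_family (\<lambda>i. product_complex (X i) (B i) (A i) (H i))"
    using assms by (intro ldpc_product_complex)
next
  fix i
  have chain: "chain_complex2 (X i)" and fin: "finite (A i)" "finite (B i)"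
    using assms by (auto simp: ldpc_css_family_def)
  obtain S where "\<And>b b'. b \<in> B i \<Longrightarrow> (\<Sum>a\<in>A i. H i b a * S a b') = (if b' = b then 1 else 0)"
    using full_row_rank_imp_right_inverse[OF fin] assms(6) by blast
  then have "full_rank_product_code (X i) (A i) (B i) (H i) S"
    using chain fin by unfold_locales auto
  note Q = full_rank_product_code.css_dim_Q[OF this] full_rank_product_code.dX_Q[OF this]
    full_rank_product_code.dZ_Q[OF this]
  show "let Q = product_complex (X i) (B i) (A i) (H i);
             C = classical_code (B i) (A i) (H i)
         in css_length Q = card (cells1 (X i)) * card (A i) + card (cells2 (X i)) * card (B i) \<and>
            css_dim Q = css_dim (X i) * f2.dim C \<and>
            dX Q = dX (X i) * min_distance C \<and>
            dZ Q = dZ (X i)"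
    unfolding Let_def using Q css_length_product_complex[OF chain fin] assms(2,5) by blast
qed

end
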